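(* For every $p\in\mathbb{R}^d\setminus\{0\}$, the series $\sum_{q\in\Lambda_p}\hat S(q)$ converges absolutely and $$H(p)^2 \;=\; 2d\,\exp\Big(\sum_{q\in\Lambda_p}\hat S(q)\Big)\,|p|^2 .$$
   Context: Let $d\ge1$. For $u:\mathbb{Z}^d\to\mathbb{R}$ the discrete Laplacian is $\Delta u(x)=\sum_{i=1}^d\big(u(x+e_i)+u(x-e_i)-2u(x)\big)$. For $p\in\mathbb{R}^d\setminus\{0\}$, the problem: $\Delta u(x)=0$ for $p\cdot x>0$, $u(x)=0$ for $p\cdot x\le 0$, $\sup_{p\cdot x>0}|u(x)-p\cdot x|<\infty$, has a unique solution $u_p:\mathbb{Z}^d\to\mathbb{R}$, and the Hamiltonian is defined by $H(p)=\Delta u_p(0)$. For $p\in\mathbb{R}^d\setminus\{0\}$ let $\Lambda_p=\{q\in\mathbb{Z}^d: p\cdot q=0\}$. Let $S$ be the $2\pi\mathbb{Z}^d$-periodic function $S(\theta)=\log\big(1-\frac1d\sum_{j=1}^d\cos\theta_j\big)$ (with a logarithmic singularity at $\theta\in2\pi\mathbb{Z}^d$), and $\hat S(q)=(2\pi)^{-d}\int_{[-\pi,\pi]^d}S(\theta)e^{-iq\cdot\theta}\,d\theta$ for $q\in\mathbb{Z}^d$ its Fourier coefficients. *)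

theory Defs
  imports "HOL-Analysis.Analysis"
begin

text \<open>The lattice Z^d is modelled as int^'n, with d = CARD('n) (so d \<ge> 1 automatically).\<close>

definition zdot :: "real^'n \<Rightarrow> int^'n \<Rightarrow> real" where
  "zdot p x = (\<Sum>i\<in>UNIV. p $ i * real_of_int (x $ i))"

definition unitz :: "'n \<Rightarrow> int^'n" where
  "unitz i = (\<chi> j. if j = i then 1 else 0)"

definition dlap :: "(int^'n \<Rightarrow> real) \<Rightarrow> int^'n \<Rightarrow> real" where
  "dlap u x = (\<Sum>i\<in>UNIV. u (x + unitz i) + u (x - unitz i) - 2 * u x)"

definition is_halfspace_sol :: "real^'n \<Rightarrow> (int^'n \<Rightarrow> real) \<Rightarrow> bool" where
  "is_halfspace_sol p u \<longleftrightarrow>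
     (\<forall>x. zdot p x > 0 \<longrightarrow> dlap u x = 0) \<and>
     (\<forall>x. zdot p x \<le> 0 \<longrightarrow> u x = 0) \<and>
     (\<exists>C. \<forall>x. zdot p x > 0 \<longrightarrow> \<bar>u x - zdot p x\<bar> \<le> C)"

definition usol :: "real^'n \<Rightarrow> int^'n \<Rightarrow> real" where
  "usol p = (THE u. is_halfspace_sol p u)"

definition Ham :: "real^'n \<Rightarrow> real" where
  "Ham p = dlap (usol p) 0"

definition Lam :: "real^'n \<Rightarrow> (int^'n) set" where
  "Lam p = {q. zdot p q = 0}"

definition Sfun :: "real^'n \<Rightarrow> real" where
  "Sfun \<theta> = ln (1 - (1 / real CARD('n)) * (\<Sum>j\<in>UNIV. cos (\<theta> $ j)))"

definition Shat :: "int^'n \<Rightarrow> complex" where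
  "Shat q = complex_of_real ((2 * pi) powi (- int CARD('n))) *
     (LINT \<theta> : cbox (- (\<chi> i. pi)) (\<chi> i. pi) | lborel.
        complex_of_real (Sfun \<theta>) * exp (- \<i> * complex_of_real (zdot \<theta> q)))"

end

(*
  Let A = 1 - s step in the Banach algebra l^1(Z^d), for 0 < s < 1, where step is the law of the simple
  random walk. Splitting log A by the sign of p.x gives the Wiener-Hopf factorisation A = a b c with
  a, b, c supported on p.x >= 0, p.x = 0, p.x <= 0. Since a = A (b c)^(-1) and A reaches one step, a is
  supported in the strip 0 <= p.x <= |p|, so its moments in the direction p exist. With e and e0 the
  total masses of a (equally, of c) and b, and m the first moment of a,
    e^2 e0 = 1 - s   and   2 e0 m^2 = s |p|^2 / d + O(e)   (zeroth and second moments of A).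
  Applying A to the bounded function u_p - p.x (cut off below the hyperplane) and dividing by c gives
    e0 m + s H(p) / (2d) = O(e e0).
  As H(p) > 0, this keeps e0 away from 0, so that -log e0 = sum over Lambda_p of sum_k s^k P(S_k = q) / k
  stays bounded as s -> 1; this is the absolute convergence, because Shat(q) = - sum_k P(S_k = q) / k.
  Then e -> 0 and the displayed relations give (H(p) / (2d))^2 = lim e0 |p|^2 / (2d).
*)
theory Submission
  imports Defs
begin

text \<open>The argument runs at s < 1 because sum_k step^k / k has infinite total mass: at s = 1
  this series defines no logarithm in l^1. What survives the limit is positivity. All coefficients
  of log A are <= 0, so the exponentials of the negated pieces have coefficients >= 0, their norms
  are their masses, and the masses of a, b, c lie in (0, 1]. Hence the constants in the estimates do
  not depend on s.

  Positivity also replaces any asymptotics of the walk. The sum for -log e0 runs over pairs (q, k)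
  with nonnegative terms, so a bound uniform in s gives absolute convergence, and the limit follows
  by monotone convergence. Since q = 0 lies in Lambda_p, the same bound contains the convergence of
  sum_k P(S_k = 0) / k, which in turn justifies integrating the logarithm series term by term and so
  identifies Shat. Thus information flows from the half-space problem to the walk: a solution with
  H(p) > 0 controls the return probabilities.\<close>

section \<open>The convolution algebra of summable functions on an abelian group\<close>

no_notation Infinite_Set_Sum.abs_summable_on (infix \<open>abs'_summable'_on\<close> 50)

text \<open>For real functions unconditional summability is absolute summability, so this is l^1 of
  the discrete group.\<close>

typedef (overloaded) 'a l1 = "{f::'a::ab_group_add \<Rightarrow> real. f summable_on UNIV}"
  morphisms cf Abs_l1
  by (rule exI[of _ "\<lambda>_. 0"]) simp

setup_lifting type_definition_l1

lemma cf_summable: "cf f summable_on A"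
  using cf[of f] by (auto intro: summable_on_subset_banach)

lemma summable_on_real_abs_iff: "(\<lambda>x. \<bar>f x\<bar>) summable_on A \<longleftrightarrow> f summable_on A"
  for f :: "'b \<Rightarrow> real"
  by (metis (no_types) real_norm_def summable_on_cong summable_on_iff_abs_summable_on_real)

lemma cf_abs_summable: "(\<lambda>x. \<bar>cf f x\<bar>) summable_on A"
  by (simp add: summable_on_real_abs_iff cf_summable)

lemma l1_eqI: "(\<And>x. cf f x = cf g x) \<Longrightarrow> f = g"
  by (simp add: cf_inject[symmetric] fun_eq_iff)

lemma ex_l1_dominated:
  assumes "g summable_on UNIV" "\<And>x. \<bar>f x\<bar> \<le> C * g x"
  shows "\<exists>h. \<forall>x. cf h x = f x"
proof -
  have "(\<lambda>x. C * g x) summable_on UNIV"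
    using assms(1) by (rule summable_on_cmult_right)
  then have "(\<lambda>x. \<bar>f x\<bar>) summable_on UNIV"
    by (rule summable_on_comparison_test) (use assms(2) in auto)
  then have "f summable_on UNIV"
    by (simp add: summable_on_real_abs_iff)
  then show ?thesis
    by (intro exI[of _ "Abs_l1 f"]) (simp add: Abs_l1_inverse)
qed

section \<open>The Banach space structure\<close>

instantiation l1 :: (ab_group_add) real_vector
begin
lift_definition zero_l1 :: "'a l1" is "\<lambda>_. 0" by simp
lift_definition plus_l1 :: "'a l1 \<Rightarrow> 'a l1 \<Rightarrow> 'a l1" is "\<lambda>f g x. f x + g x"
  by (rule summable_on_add)
lift_definition uminus_l1 :: "'a l1 \<Rightarrow> 'a l1" is "\<lambda>f x. - f x"
  by (simp add: summable_on_uminus)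
lift_definition minus_l1 :: "'a l1 \<Rightarrow> 'a l1 \<Rightarrow> 'a l1" is "\<lambda>f g x. f x - g x"
proof -
  fix f g :: "'a \<Rightarrow> real" assume "f summable_on UNIV" "g summable_on UNIV"
  then have "(\<lambda>x. f x + - g x) summable_on UNIV"
    by (intro summable_on_add) (simp_all add: summable_on_uminus)
  then show "(\<lambda>x. f x - g x) summable_on UNIV" by simp
qed
lift_definition scaleR_l1 :: "real \<Rightarrow> 'a l1 \<Rightarrow> 'a l1" is "\<lambda>c f x. c * f x"
  by (rule summable_on_cmult_right)
instance
  by standard (rule l1_eqI, simp add: zero_l1.rep_eq plus_l1.rep_eq uminus_l1.rep_eq minus_l1.rep_eq
    scaleR_l1.rep_eq algebra_simps)+
end

lemmas cf_linear [simp] = zero_l1.rep_eq plus_l1.rep_eq uminus_l1.rep_eq minus_l1.rep_eq scaleR_l1.rep_eq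

instantiation l1 :: (ab_group_add) real_normed_vector
begin
definition norm_l1 :: "'a l1 \<Rightarrow> real" where
  "norm_l1 f = infsum (\<lambda>x. \<bar>cf f x\<bar>) UNIV"
definition sgn_l1 :: "'a l1 \<Rightarrow> 'a l1" where
  "sgn_l1 f = f /\<^sub>R norm f"
definition dist_l1 :: "'a l1 \<Rightarrow> 'a l1 \<Rightarrow> real" where
  "dist_l1 f g = norm (f - g)"
definition uniformity_l1 :: "('a l1 \<times> 'a l1) filter" where
  "uniformity_l1 = (INF e\<in>{0<..}. principal {(x, y). dist x y < e})"
definition open_l1 :: "'a l1 set \<Rightarrow> bool" where
  "open_l1 U \<longleftrightarrow> (\<forall>x\<in>U. eventually (\<lambda>(x', y). x' = x \<longrightarrow> y \<in> U) uniformity)"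
instance
proof
  fix f g :: "'a l1" and c :: real
  show "norm f = 0 \<longleftrightarrow> f = 0"
  proof
    assume "norm f = 0"
    then have "\<bar>cf f x\<bar> = 0" for x
      unfolding norm_l1_def
      by (intro nonneg_infsum_le_0D[of "\<lambda>x. \<bar>cf f x\<bar>" UNIV]) (auto intro: cf_abs_summable)
    then show "f = 0" by (intro l1_eqI) simp
  qed (simp add: norm_l1_def)
  show "norm (f + g) \<le> norm f + norm g"
    unfolding norm_l1_def
    by (subst infsum_add[OF cf_abs_summable cf_abs_summable, symmetric],
        rule infsum_mono[OF cf_abs_summable summable_on_add[OF cf_abs_summable cf_abs_summable]])
       simp
  show "norm (c *\<^sub>R f) = \<bar>c\<bar> * norm f"
    by (simp add: norm_l1_def abs_mult infsum_cmult_right')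
qed (rule sgn_l1_def dist_l1_def uniformity_l1_def open_l1_def)+
end

lemma norm_l1_has_sum: "((\<lambda>x. \<bar>cf f x\<bar>) has_sum norm f) UNIV"
  unfolding norm_l1_def by (intro has_sum_infsum cf_abs_summable)

lemma abs_cf_le_norm: "\<bar>cf f x\<bar> \<le> norm f"
  using finite_sum_le_infsum[OF cf_abs_summable[of f UNIV], of "{x}"] by (simp add: norm_l1_def)

lemma bounded_linear_cf: "bounded_linear (\<lambda>f. cf f x)"
  by (rule bounded_linear_intro[where K = 1]) (auto simp: abs_cf_le_norm)

instance l1 :: (ab_group_add) banach
proof
  fix X :: "nat \<Rightarrow> 'a l1"
  assume X: "Cauchy X"
  have "Cauchy (\<lambda>n. cf (X n) x)" for x
    by (rule bounded_linear.Cauchy[OF bounded_linear_cf X])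
  then have "\<forall>x. \<exists>l. (\<lambda>n. cf (X n) x) \<longlonglongrightarrow> l"
    by (metis Cauchy_convergent convergent_def)
  then obtain f where f: "\<And>x. (\<lambda>n. cf (X n) x) \<longlonglongrightarrow> f x"
    by metis
  \<comment> \<open>Finite partial sums are used because \<open>f\<close> is not yet known to be
    summable; in a finite sum the second index of the Cauchy estimate can go to infinity
    termwise.\<close>
  have bound: "\<exists>N. \<forall>n\<ge>N. \<forall>F. finite F \<longrightarrow> (\<Sum>x\<in>F. \<bar>cf (X n) x - f x\<bar>) \<le> e" if e: "e > 0" for e
  proof -
    obtain N where N: "\<And>n k. n \<ge> N \<Longrightarrow> k \<ge> N \<Longrightarrow> norm (X n - X k) < e"
      using CauchyD[OF X e] by auto
    have "(\<Sum>x\<in>F. \<bar>cf (X n) x - f x\<bar>) \<le> e" if "n \<ge> N" "finite F" for n F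
    proof (rule LIMSEQ_le_const2)
      show "(\<lambda>k. \<Sum>x\<in>F. \<bar>cf (X n) x - cf (X k) x\<bar>) \<longlonglongrightarrow> (\<Sum>x\<in>F. \<bar>cf (X n) x - f x\<bar>)"
        by (intro tendsto_intros f)
      have "(\<Sum>x\<in>F. \<bar>cf (X n) x - cf (X k) x\<bar>) \<le> e" if "k \<ge> N" for k
      proof -
        have "(\<Sum>x\<in>F. \<bar>cf (X n - X k) x\<bar>) \<le> norm (X n - X k)"
          unfolding norm_l1_def by (intro finite_sum_le_infsum cf_abs_summable \<open>finite F\<close>) auto
        also have "\<dots> < e" using N \<open>n \<ge> N\<close> that by blast
        finally show ?thesis by simp
      qed
      then show "\<exists>M. \<forall>k\<ge>M. (\<Sum>x\<in>F. \<bar>cf (X n) x - cf (X k) x\<bar>) \<le> e" by blast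
    qed
    then show ?thesis by blast
  qed
  obtain N where N: "\<And>F. finite F \<Longrightarrow> (\<Sum>x\<in>F. \<bar>cf (X N) x - f x\<bar>) \<le> 1"
    using bound[of 1] by auto
  have "(\<lambda>x. \<bar>cf (X N) x - f x\<bar>) summable_on UNIV"
    by (rule nonneg_bdd_above_summable_on) (auto simp: bdd_above_def intro!: exI[of _ 1] N)
  then have "(\<lambda>x. cf (X N) x - f x) summable_on UNIV"
    by (simp add: summable_on_real_abs_iff)
  from summable_on_add[OF cf_summable[of "X N"] summable_on_uminus[THEN iffD2, OF this]]
  have "f summable_on UNIV" by simp
  then have cf_f: "cf (Abs_l1 f) = f" by (simp add: Abs_l1_inverse)
  have "X \<longlonglongrightarrow> Abs_l1 f"
  proof (rule LIMSEQ_I)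
    fix e :: real assume "e > 0"
    then obtain N where N: "\<And>n F. n \<ge> N \<Longrightarrow> finite F \<Longrightarrow> (\<Sum>x\<in>F. \<bar>cf (X n) x - f x\<bar>) \<le> e/2"
      using bound[of "e/2"] by auto
    have "norm (X n - Abs_l1 f) < e" if "n \<ge> N" for n
    proof -
      have "norm (X n - Abs_l1 f) \<le> e/2"
        unfolding norm_l1_def
        by (rule infsum_le_finite_sums) (use N[OF that] cf_abs_summable[of "X n - Abs_l1 f" UNIV] in \<open>auto simp: cf_f\<close>)
      then show ?thesis using \<open>e > 0\<close> by simp
    qed
    then show "\<exists>N. \<forall>n\<ge>N. norm (X n - Abs_l1 f) < e" by blast
  qed
  then show "convergent X" by (auto simp: convergent_def)
qed


section \<open>Convolution and its action on bounded functions\<close>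

lemma summable_cf_bounded:
  fixes e :: "'a::ab_group_add \<Rightarrow> 'b::banach"
  assumes "\<And>x. norm (e x) \<le> B"
  shows "(\<lambda>x. cf f x *\<^sub>R e x) abs_summable_on A"
proof (rule Infinite_Sum.abs_summable_on_comparison_test)
  have "(\<lambda>x. B * cf f x) summable_on A"
    by (intro summable_on_cmult_right cf_summable)
  then show "(\<lambda>x. B * cf f x) abs_summable_on A"
    by (simp only: real_norm_def summable_on_real_abs_iff)
  fix x
  have "\<bar>cf f x\<bar> * norm (e x) \<le> \<bar>cf f x\<bar> * \<bar>B\<bar>"
    using assms[of x] by (intro mult_left_mono) auto
  then show "norm (cf f x *\<^sub>R e x) \<le> norm (B * cf f x)"
    by (simp add: abs_mult mult.commute)
qed

lemmas summable_cf_bounded_real = summable_cf_bounded[where 'b = real, simplified real_scaleR_def, THEN abs_summable_summable]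

lemma abs_summable_cf_product:
  "(\<lambda>(y, z). cf f y * cf g z) abs_summable_on UNIV"
proof -
  have "(\<lambda>yz. cf f (fst yz) * cf g (snd yz)) abs_summable_on (UNIV \<times> UNIV)"
    by (subst Infinite_Sum.abs_summable_on_Sigma_iff)
      (simp add: abs_mult infsum_cmult_right' summable_on_cmult_left summable_on_cmult_right cf_abs_summable)
  then show ?thesis by (simp add: case_prod_unfold)
qed

text \<open>This change of variables turns the double sum of a convolution into a product of two
  sums.\<close>

lemma bij_shear: "bij (\<lambda>(x, y). (y, x - y :: 'a::ab_group_add))"
  by (rule bij_betw_byWitness[where f' = "\<lambda>(y, z). (z + y, y)"]) auto

lemma abs_summable_cf_conv:
  "(\<lambda>(x, y). cf f y * cf g (x - y)) abs_summable_on UNIV"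
  using summable_on_reindex_bij_betw[OF bij_shear, of "\<lambda>(y, z). norm (cf f y * cf g z)"]
    abs_summable_cf_product[of f g]
  by (simp add: case_prod_unfold)

text \<open>One Fubini argument for two purposes: with \<open>e\<close> a reflected translate of a
  bounded function it yields \<open>act_times\<close>, hence associativity; with \<open>e\<close> a
  character it yields multiplicativity of \<open>fourier\<close>.\<close>

lemma infsum_cf_conv_swap:
  fixes e :: "'a::ab_group_add \<Rightarrow> 'b::banach"
  assumes "\<And>x. norm (e x) \<le> B"
  shows "(\<Sum>\<^sub>\<infinity>x. (\<Sum>\<^sub>\<infinity>y. cf f y * cf g (x - y)) *\<^sub>R e x)
       = (\<Sum>\<^sub>\<infinity>y. cf f y *\<^sub>R (\<Sum>\<^sub>\<infinity>z. cf g z *\<^sub>R e (z + y)))"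
proof -
  have *: "(\<lambda>(x, y). (cf f y * cf g (x - y)) *\<^sub>R e x) abs_summable_on UNIV"
  proof (rule Infinite_Sum.abs_summable_on_comparison_test)
    have "(\<lambda>xy. B * (case xy of (x, y) \<Rightarrow> cf f y * cf g (x - y))) summable_on UNIV"
      by (rule summable_on_cmult_right[OF abs_summable_summable[OF abs_summable_cf_conv]])
    then show "(\<lambda>xy. B * (case xy of (x, y) \<Rightarrow> cf f y * cf g (x - y))) abs_summable_on UNIV"
      by (simp only: real_norm_def summable_on_real_abs_iff)
    fix xy :: "'a \<times> 'a"
    have "norm (e (fst xy)) \<le> \<bar>B\<bar>"
      using assms[of "fst xy"] by simp
    then show "norm (case xy of (x, y) \<Rightarrow> (cf f y * cf g (x - y)) *\<^sub>R e x)
      \<le> norm (B * (case xy of (x, y) \<Rightarrow> cf f y * cf g (x - y)))"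
      by (simp add: case_prod_unfold abs_mult mult.commute mult_right_mono)
  qed
  have y: "(\<lambda>y. cf f y * cf g (x - y)) summable_on UNIV" for x
    by (rule summable_cf_bounded_real[of "\<lambda>y. cf g (x - y)" "norm g"]) (simp add: abs_cf_le_norm)
  have "(\<Sum>\<^sub>\<infinity>x. (\<Sum>\<^sub>\<infinity>y. cf f y * cf g (x - y)) *\<^sub>R e x)
      = (\<Sum>\<^sub>\<infinity>x. \<Sum>\<^sub>\<infinity>y. (cf f y * cf g (x - y)) *\<^sub>R e x)"
    by (intro infsum_cong infsum_scaleR_left[symmetric] y)
  also have "\<dots> = (\<Sum>\<^sub>\<infinity>y. \<Sum>\<^sub>\<infinity>x. (cf f y * cf g (x - y)) *\<^sub>R e x)"
    using abs_summable_summable[OF *] by (intro infsum_swap_banach) simp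
  also have "\<dots> = (\<Sum>\<^sub>\<infinity>y. \<Sum>\<^sub>\<infinity>z. cf f y *\<^sub>R (cf g z *\<^sub>R e (z + y)))"
  proof (rule infsum_cong)
    fix y :: 'a
    have "bij (\<lambda>z. z + y)"
      by (rule bij_betw_byWitness[where f' = "\<lambda>z. z - y"]) auto
    from infsum_reindex_bij_betw[OF this, of "\<lambda>x. (cf f y * cf g (x - y)) *\<^sub>R e x"]
    show "(\<Sum>\<^sub>\<infinity>x. (cf f y * cf g (x - y)) *\<^sub>R e x) = (\<Sum>\<^sub>\<infinity>z. cf f y *\<^sub>R (cf g z *\<^sub>R e (z + y)))"
      by simp
  qed
  also have "\<dots> = (\<Sum>\<^sub>\<infinity>y. cf f y *\<^sub>R (\<Sum>\<^sub>\<infinity>z. cf g z *\<^sub>R e (z + y)))"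
    by (intro infsum_cong infsum_scaleR_right)
  finally show ?thesis .
qed

text \<open>Convolution of an l^1 element with a function that is only bounded. The function to
  which A is eventually applied, the solution minus its linear part, is bounded but need not be
  summable, so the product of the algebra would not suffice.\<close>

definition act :: "'a::ab_group_add l1 \<Rightarrow> ('a \<Rightarrow> real) \<Rightarrow> 'a \<Rightarrow> real" where
  "act f \<phi> x = (\<Sum>\<^sub>\<infinity>y. cf f y * \<phi> (x - y))"

lift_definition delta :: "'a::ab_group_add \<Rightarrow> 'a l1" is "\<lambda>a x. if x = a then 1 else 0"
  by (rule finite_nonzero_values_imp_summable_on) simp

lemma act_delta: "act (delta a) \<phi> x = \<phi> (x - a)"
proof -
  have "act (delta a) \<phi> x = (\<Sum>\<^sub>\<infinity>y\<in>{a}. cf (delta a) y * \<phi> (x - y))"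
    unfolding act_def by (rule infsum_cong_neutral) (auto simp: delta.rep_eq)
  then show ?thesis by (simp add: delta.rep_eq)
qed

lemma act_summable:
  "(\<And>x. \<bar>\<phi> x\<bar> \<le> B) \<Longrightarrow> (\<lambda>y. cf f y * \<phi> (x - y)) summable_on A"
  using summable_cf_bounded_real[of "\<lambda>y. \<phi> (x - y)" B] by simp

lemmas conv_summable = act_summable[where \<phi> = "cf g" for g, OF abs_cf_le_norm]

lemma act_add: "(\<And>x. \<bar>\<phi> x\<bar> \<le> B) \<Longrightarrow> act (f + g) \<phi> x = act f \<phi> x + act g \<phi> x"
  unfolding act_def by (subst infsum_add[symmetric]) (auto intro!: act_summable simp: distrib_right)

lemma act_scaleR: "act (c *\<^sub>R f) \<phi> x = c * act f \<phi> x"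
  unfolding act_def by (simp add: mult.assoc infsum_cmult_right')

lemma act_bound: "(\<And>x. \<bar>\<phi> x\<bar> \<le> B) \<Longrightarrow> \<bar>act f \<phi> x\<bar> \<le> norm f * B"
proof -
  assume B: "\<And>x. \<bar>\<phi> x\<bar> \<le> B"
  have "norm (\<Sum>\<^sub>\<infinity>y. cf f y * \<phi> (x - y)) \<le> norm f * B"
  proof (rule norm_infsum_le)
    show "((\<lambda>y. cf f y * \<phi> (x - y)) has_sum (\<Sum>\<^sub>\<infinity>y. cf f y * \<phi> (x - y))) UNIV"
      by (intro has_sum_infsum act_summable[OF B])
    show "((\<lambda>y. \<bar>cf f y\<bar> * B) has_sum norm f * B) UNIV"
      by (intro has_sum_cmult_left norm_l1_has_sum)
  qed (simp_all add: abs_mult mult_left_mono B)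
  then show ?thesis by (simp add: act_def)
qed

lemma act_commute: "act f (cf g) x = act g (cf f) x"
proof -
  have "bij (\<lambda>y. x - y)"
    by (rule bij_betw_byWitness[where f' = "\<lambda>y. x - y"]) auto
  from infsum_reindex_bij_betw[OF this, of "\<lambda>y. cf g y * cf f (x - y)"]
  show ?thesis by (simp add: act_def mult.commute)
qed

instantiation l1 :: (ab_group_add) "{comm_ring_1, real_normed_algebra_1}"
begin
definition one_l1 :: "'a l1" where "one_l1 = delta 0"
lift_definition times_l1 :: "'a l1 \<Rightarrow> 'a l1 \<Rightarrow> 'a l1" is
  "\<lambda>f g x. \<Sum>\<^sub>\<infinity>y. f y * g (x - y)"
proof -
  fix f g :: "'a \<Rightarrow> real"
  assume fg: "f summable_on UNIV" "g summable_on UNIV"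
  have "(\<lambda>(x, y). f y * g (x - y)) summable_on (UNIV \<times> UNIV)"
    using abs_summable_summable[OF abs_summable_cf_conv[of "Abs_l1 f" "Abs_l1 g"]] fg
    by (simp add: Abs_l1_inverse)
  then show "(\<lambda>x. \<Sum>\<^sub>\<infinity>y. f y * g (x - y)) summable_on UNIV"
    by (rule summable_on_Sigma_banach)
qed

lemma cf_times: "cf (f * g) = act f (cf g)"
  by (simp add: times_l1.rep_eq act_def fun_eq_iff)

lemma act_times:
  assumes "\<And>x. \<bar>\<phi> x\<bar> \<le> B"
  shows "act (f * g) \<phi> x = act f (act g \<phi>) x"
  using infsum_cf_conv_swap[of "\<lambda>w. \<phi> (x - w)" B f g] assms
  by (simp add: act_def times_l1.rep_eq algebra_simps)

instance
proof
  have comm: "f * g = g * f" for f g :: "'a l1"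
    by (rule l1_eqI) (simp add: cf_times act_commute)
  have scale: "c *\<^sub>R f * g = c *\<^sub>R (f * g)" for f g :: "'a l1" and c
    by (rule l1_eqI) (simp add: cf_times act_scaleR)
  have one: "1 * f = f" for f :: "'a l1"
    by (rule l1_eqI) (simp add: cf_times one_l1_def act_delta)
  have distr: "(f + g) * h = f * h + g * h" for f g h :: "'a l1"
    by (rule l1_eqI) (simp add: cf_times act_add[where \<phi> = "cf h", OF abs_cf_le_norm])
  fix f g h :: "'a l1" and c :: real
  show "f * g * h = f * (g * h)"
    by (rule l1_eqI) (simp add: cf_times act_times[where \<phi> = "cf h", OF abs_cf_le_norm])
  show "f * g = g * f" by (rule comm)
  show "1 * f = f" "f * 1 = f" by (metis one comm)+
  show "(f + g) * h = f * h + g * h" "f * (g + h) = f * g + f * h" by (metis distr comm)+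
  show "c *\<^sub>R f * g = c *\<^sub>R (f * g)" by (rule scale)
  show "f * c *\<^sub>R g = c *\<^sub>R (f * g)" by (metis comm scale)
  have "cf (0::'a l1) 0 \<noteq> cf 1 0" by (simp add: one_l1_def delta.rep_eq)
  then show "(0::'a l1) \<noteq> 1" by metis
  have "norm (1::'a l1) = (\<Sum>\<^sub>\<infinity>x\<in>{0}. \<bar>cf (1::'a l1) x\<bar>)"
    unfolding norm_l1_def by (rule infsum_cong_neutral) (auto simp: one_l1_def delta.rep_eq)
  then show "norm (1::'a l1) = 1" by (simp add: one_l1_def delta.rep_eq)
  show "norm (f * g) \<le> norm f * norm g"
  proof -
    have S: "(\<lambda>(x, y). \<bar>cf f y\<bar> * \<bar>cf g (x - y)\<bar>) summable_on UNIV \<times> UNIV"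
      using abs_summable_cf_conv[of f g] by (simp add: case_prod_unfold abs_mult)
    have "norm (f * g) \<le> (\<Sum>\<^sub>\<infinity>x. \<Sum>\<^sub>\<infinity>y. \<bar>cf f y\<bar> * \<bar>cf g (x - y)\<bar>)"
      unfolding norm_l1_def
    proof (rule infsum_mono[OF cf_abs_summable])
      show "(\<lambda>x. \<Sum>\<^sub>\<infinity>y. \<bar>cf f y\<bar> * \<bar>cf g (x - y)\<bar>) summable_on UNIV"
        using S by (rule summable_on_Sigma_banach)
      fix x
      have "(\<lambda>y. cf f y * cf g (x - y)) abs_summable_on UNIV"
        using conv_summable[of f g x UNIV] by (simp only: real_norm_def summable_on_real_abs_iff)
      from norm_infsum_bound[OF this]
      show "\<bar>cf (f * g) x\<bar> \<le> (\<Sum>\<^sub>\<infinity>y. \<bar>cf f y\<bar> * \<bar>cf g (x - y)\<bar>)"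
        by (simp add: times_l1.rep_eq abs_mult)
    qed
    also have "\<dots> = (\<Sum>\<^sub>\<infinity>(x, y). \<bar>cf f y\<bar> * \<bar>cf g (x - y)\<bar>)"
      using infsum_Sigma'_banach[OF S] by simp
    also have "\<dots> = (\<Sum>\<^sub>\<infinity>(y, z). \<bar>cf f y\<bar> * \<bar>cf g z\<bar>)"
      using infsum_reindex_bij_betw[OF bij_shear, of "\<lambda>(y, z). \<bar>cf f y\<bar> * \<bar>cf g z\<bar>"]
      by (simp add: case_prod_unfold)
    also have "\<dots> = (\<Sum>\<^sub>\<infinity>y. \<Sum>\<^sub>\<infinity>z. \<bar>cf f y\<bar> * \<bar>cf g z\<bar>)"
      using infsum_Sigma'_banach[of "\<lambda>y z. \<bar>cf f y\<bar> * \<bar>cf g z\<bar>" UNIV "\<lambda>_. UNIV"] abs_summable_cf_product[of f g]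
      by (simp add: case_prod_unfold abs_mult)
    also have "\<dots> = norm f * norm g"
      by (simp add: norm_l1_def infsum_cmult_right' infsum_cmult_left')
    finally show ?thesis .
  qed
qed
end

lemma cf_one: "cf 1 x = (if x = 0 then 1 else 0)"
  by (simp add: one_l1_def delta.rep_eq)

lemma act_nonneg: "(\<And>x. cf f x \<ge> 0) \<Longrightarrow> (\<And>x. \<phi> x \<ge> 0) \<Longrightarrow> act f \<phi> x \<ge> 0"
  unfolding act_def by (intro infsum_nonneg) simp

section \<open>Supports, positivity and the exponential\<close>

definition supp_in :: "'a::ab_group_add l1 \<Rightarrow> 'a set \<Rightarrow> bool" where
  "supp_in f C \<longleftrightarrow> (\<forall>x. x \<notin> C \<longrightarrow> cf f x = 0)"

lemma supp_inD: "supp_in f C \<Longrightarrow> x \<notin> C \<Longrightarrow> cf f x = 0"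
  by (simp add: supp_in_def)

lemma supp_in_mono: "supp_in f C \<Longrightarrow> C \<subseteq> D \<Longrightarrow> supp_in f D"
  by (auto simp: supp_in_def)

lemma act_eq_0: "(\<And>y. cf f y \<noteq> 0 \<Longrightarrow> \<phi> (x - y) = 0) \<Longrightarrow> act f \<phi> x = 0"
  unfolding act_def by (rule infsum_0) auto

lemma supp_in_times:
  assumes "supp_in f C" "supp_in g D" "\<And>c d. c \<in> C \<Longrightarrow> d \<in> D \<Longrightarrow> c + d \<in> E"
  shows "supp_in (f * g) E"
  unfolding supp_in_def
proof (intro allI impI)
  fix x assume x: "x \<notin> E"
  show "cf (f * g) x = 0"
    unfolding cf_times
  proof (rule act_eq_0)
    fix y assume "cf f y \<noteq> 0"
    then have "y \<in> C" using assms(1) by (auto simp: supp_in_def)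
    then have "x - y \<notin> D" using assms(3)[of y "x - y"] x by auto
    then show "cf g (x - y) = 0" using assms(2) by (auto simp: supp_in_def)
  qed
qed

lift_definition restr :: "'a::ab_group_add set \<Rightarrow> 'a l1 \<Rightarrow> 'a l1" is
  "\<lambda>C f x. if x \<in> C then f x else 0"
proof -
  fix C and f :: "'a \<Rightarrow> real" assume "f summable_on UNIV"
  then have "(\<lambda>x. \<bar>f x\<bar>) summable_on UNIV" by (simp add: summable_on_real_abs_iff)
  then have "(\<lambda>x. \<bar>if x \<in> C then f x else 0\<bar>) summable_on UNIV"
    by (rule summable_on_comparison_test) auto
  then show "(\<lambda>x. if x \<in> C then f x else 0) summable_on UNIV"
    by (simp only: summable_on_real_abs_iff)
qed

lemma supp_in_restr: "supp_in (restr C f) C"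
  by (simp add: supp_in_def restr.rep_eq)

text \<open>The series of exp x - 1 has nonnegative coefficients and no constant term, so its
  partial sums stay in the cone. Subtracting 1 admits cones without unit, such as the elements
  supported in an open half-space; the other application is the cone of nonnegative
  coefficients.\<close>

lemma exp_minus_one_mem_closed_cone:
  fixes x :: "'a::{real_normed_algebra_1, banach}"
  assumes V: "closed V" "0 \<in> V" "\<And>y z. y \<in> V \<Longrightarrow> z \<in> V \<Longrightarrow> y + z \<in> V"
    "\<And>y z. y \<in> V \<Longrightarrow> z \<in> V \<Longrightarrow> y * z \<in> V" "\<And>c y. c \<ge> 0 \<Longrightarrow> y \<in> V \<Longrightarrow> c *\<^sub>R y \<in> V"
    and x: "x \<in> V"
  shows "exp x - 1 \<in> V"
proof -
  have "(\<lambda>n. x ^ Suc n /\<^sub>R fact (Suc n)) sums (exp x - 1)"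
    using exp_converges[of x] by (subst sums_Suc_iff) simp
  moreover have "(\<Sum>i<n. x ^ Suc i /\<^sub>R fact (Suc i)) \<in> V" for n
  proof (induction n)
    case (Suc n)
    have "x ^ Suc n \<in> V" by (induction n) (use x V(4) in \<open>auto\<close>)
    then show ?case using Suc V(3,5) by simp
  qed (simp add: V(2))
  ultimately show ?thesis
    using V(1) unfolding sums_def by (intro Lim_in_closed_set[of V _ sequentially]) auto
qed

lemma exp_bounded_linear_mult:
  fixes T :: "'a::{real_normed_algebra_1, banach} \<Rightarrow> 'b::{real_normed_algebra_1, banach}"
  assumes T: "bounded_linear T" "\<And>x y. T (x * y) = T x * T y" "T 1 = 1"
  shows "T (exp x) = exp (T x)"
proof -
  have pow: "T (x ^ n) = T x ^ n" for n by (induction n) (simp_all add: T)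
  have "(\<lambda>n. T (x ^ n /\<^sub>R fact n)) sums T (exp x)"
    by (intro bounded_linear.sums[OF T(1)] exp_converges)
  then have "(\<lambda>n. T x ^ n /\<^sub>R fact n) sums T (exp x)"
    by (simp add: linear_cmul[OF bounded_linear.linear[OF T(1)]] pow)
  then show ?thesis using exp_converges sums_unique2 by blast
qed

lemma closed_cf_set: "closed {f. \<forall>x. cf f x \<in> K x}" if "\<And>x. closed (K x)"
proof -
  have "closed ((\<lambda>f. cf f x) -` K x)" for x
    by (intro continuous_closed_vimage that) (simp add: linear_continuous_at bounded_linear_cf)
  then have "closed (\<Inter>x. (\<lambda>f. cf f x) -` K x)" by blast
  moreover have "(\<Inter>x. (\<lambda>f. cf f x) -` K x) = {f. \<forall>x. cf f x \<in> K x}" by auto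
  ultimately show ?thesis by simp
qed

lemma supp_in_exp_minus_one:
  assumes "supp_in f C" "\<And>c d. c \<in> C \<Longrightarrow> d \<in> C \<Longrightarrow> c + d \<in> C"
  shows "supp_in (exp f - 1) C"
proof -
  have "closed {f. \<forall>x. cf f x \<in> (if x \<in> C then UNIV else {0})}" by (rule closed_cf_set) simp
  moreover have "{f. \<forall>x. cf f x \<in> (if x \<in> C then UNIV else {0})} = {f. supp_in f C}"
    by (auto simp: supp_in_def)
  ultimately have "closed {f. supp_in f C}" by simp
  moreover have "supp_in (g * h) C" if "supp_in g C" "supp_in h C" for g h
    by (rule supp_in_times[OF that assms(2)])
  ultimately have "exp f - 1 \<in> {f. supp_in f C}"
    by (intro exp_minus_one_mem_closed_cone) (use assms(1) in simp_all, simp_all add: supp_in_def)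
  then show ?thesis by simp
qed

lemma cf_exp_nonneg:
  assumes "\<And>x. cf f x \<ge> 0"
  shows "cf (exp f) x \<ge> 0"
proof -
  have "closed {f :: 'a l1. \<forall>x. cf f x \<in> {0..}}" by (rule closed_cf_set) simp
  then have "exp f - 1 \<in> {f. \<forall>x. cf f x \<in> {0..}}"
    by (rule exp_minus_one_mem_closed_cone) (use assms in \<open>auto simp: cf_times intro: act_nonneg\<close>)
  then show ?thesis by (auto simp: cf_one dest!: spec[of _ x] split: if_splits)
qed

section \<open>Characters and weights\<close>

definition fourier :: "('a::ab_group_add \<Rightarrow> 'b::{real_normed_field, banach}) \<Rightarrow> 'a l1 \<Rightarrow> 'b" where
  "fourier e f = (\<Sum>\<^sub>\<infinity>x. cf f x *\<^sub>R e x)"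

definition is_character :: "('a::ab_group_add \<Rightarrow> 'b::{real_normed_field, banach}) \<Rightarrow> bool" where
  "is_character e \<longleftrightarrow> (\<forall>x. norm (e x) = 1) \<and> (\<forall>x y. e (x + y) = e x * e y)"

context
  fixes e :: "'a::ab_group_add \<Rightarrow> 'b::{real_normed_field, banach}"
  assumes e: "is_character e"
begin

lemma fourier_summable: "(\<lambda>x. cf f x *\<^sub>R e x) summable_on A"
  by (rule abs_summable_summable, rule summable_cf_bounded[where B = 1]) (use e in \<open>simp add: is_character_def\<close>)

lemma fourier_delta: "fourier e (delta a) = e a"
proof -
  have "fourier e (delta a) = (\<Sum>\<^sub>\<infinity>x\<in>{a}. cf (delta a) x *\<^sub>R e x)"
    unfolding fourier_def by (rule infsum_cong_neutral) (auto simp: delta.rep_eq)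
  then show ?thesis by (simp add: delta.rep_eq)
qed

lemma fourier_one: "fourier e 1 = 1"
proof -
  have "e 0 * e 0 = e 0" "norm (e 0) = 1"
    using e by (metis add_0 is_character_def)+
  then have "e 0 = 1" by (metis mult_cancel_right1 norm_zero zero_neq_one)
  then show ?thesis by (simp add: one_l1_def fourier_delta)
qed

lemma bounded_linear_fourier: "bounded_linear (fourier e)"
proof (rule bounded_linear_intro[where K = 1])
  fix f g :: "'a l1" and c :: real
  show "fourier e (f + g) = fourier e f + fourier e g"
    by (simp add: fourier_def scaleR_add_left infsum_add fourier_summable)
  show "fourier e (c *\<^sub>R f) = c *\<^sub>R fourier e f"
    by (simp add: fourier_def infsum_scaleR_right flip: scaleR_scaleR)
  have "norm (fourier e f) \<le> norm f" unfolding fourier_def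
    by (rule norm_infsum_le[OF has_sum_infsum norm_l1_has_sum])
       (use e in \<open>auto simp: is_character_def fourier_summable\<close>)
  then show "norm (fourier e f) \<le> norm f * 1" by simp
qed

lemma fourier_times: "fourier e (f * g) = fourier e f * fourier e g"
proof -
  have "fourier e (f * g) = (\<Sum>\<^sub>\<infinity>y. cf f y *\<^sub>R (\<Sum>\<^sub>\<infinity>z. cf g z *\<^sub>R e (z + y)))"
    unfolding fourier_def times_l1.rep_eq
    by (rule infsum_cf_conv_swap[where B = 1]) (use e in \<open>auto simp: is_character_def\<close>)
  also have "\<dots> = (\<Sum>\<^sub>\<infinity>y. (cf f y *\<^sub>R e y) * fourier e g)"
  proof (rule infsum_cong)
    fix y
    have "(\<Sum>\<^sub>\<infinity>z. cf g z *\<^sub>R e (z + y)) = (\<Sum>\<^sub>\<infinity>z. (cf g z *\<^sub>R e z) * e y)"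
      using e by (simp add: is_character_def)
    also have "\<dots> = fourier e g * e y"
      unfolding fourier_def by (rule infsum_cmult_left')
    finally show "cf f y *\<^sub>R (\<Sum>\<^sub>\<infinity>z. cf g z *\<^sub>R e (z + y)) = (cf f y *\<^sub>R e y) * fourier e g"
      by (simp add: mult.commute)
  qed
  also have "\<dots> = fourier e f * fourier e g"
    unfolding fourier_def by (rule infsum_cmult_left')
  finally show ?thesis .
qed

lemma fourier_power: "fourier e (f ^ n) = fourier e f ^ n"
  by (induction n) (simp_all add: fourier_one fourier_times)

lemma fourier_exp: "fourier e (exp f) = exp (fourier e f)"
  by (rule exp_bounded_linear_mult[OF bounded_linear_fourier fourier_times fourier_one])

end

text \<open>Multiplication by an additive weight is a derivation of the convolution algebra, because
  w x = w y + w (x - y) under the sum. Moments of products are computed this way. The weighted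
  elements are given as \<open>f'\<close> and \<open>g'\<close>, since a weighted summable function
  may fail to be summable.\<close>

lemma leibniz:
  assumes w: "\<And>x y. w (x + y) = w x + w y"
    and f: "\<And>x. cf f' x = w x * cf f x" and g: "\<And>x. cf g' x = w x * cf g x"
  shows "cf (f' * g + f * g') x = w x * cf (f * g) x"
proof -
  have "cf (f' * g + f * g') x = (\<Sum>\<^sub>\<infinity>y. cf f' y * cf g (x - y) + cf f y * cf g' (x - y))"
    by (simp add: times_l1.rep_eq infsum_add conv_summable)
  also have "\<dots> = (\<Sum>\<^sub>\<infinity>y. w x * (cf f y * cf g (x - y)))"
  proof (rule infsum_cong)
    fix y
    have "w x = w y + w (x - y)" using w[of y "x - y"] by simp
    then show "cf f' y * cf g (x - y) + cf f y * cf g' (x - y) = w x * (cf f y * cf g (x - y))"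
      by (simp add: f g algebra_simps)
  qed
  also have "\<dots> = w x * cf (f * g) x"
    by (simp add: times_l1.rep_eq infsum_cmult_right')
  finally show ?thesis .
qed

section \<open>Fourier series on the lattice\<close>

lemma zdot_add: "zdot p (x + y) = zdot p x + zdot p y"
  by (simp add: zdot_def algebra_simps sum.distrib)

lemma zdot_minus: "zdot p (- x) = - zdot p x"
  by (simp add: zdot_def sum_negf)

lemma zdot_diff: "zdot p (x - y) = zdot p x - zdot p y"
  by (simp add: zdot_def algebra_simps sum_subtractf)

lemma zdot_zero [simp]: "zdot p 0 = 0"
  by (simp add: zdot_def)

lemma zdot_unitz: "zdot p (unitz i) = p $ i"
proof -
  have "zdot p (unitz i) = (\<Sum>j\<in>UNIV. if j = i then p $ j else 0)"
    unfolding zdot_def unitz_def by (intro sum.cong) auto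
  then show ?thesis by simp
qed

definition chi :: "real^'n \<Rightarrow> int^'n \<Rightarrow> complex" where
  "chi \<theta> q = exp (\<i> * complex_of_real (zdot \<theta> q))"

lemma chi_zero [simp]: "chi \<theta> 0 = 1"
  by (simp add: chi_def)

lemma chi_add: "chi \<theta> (x + y) = chi \<theta> x * chi \<theta> y"
  by (simp add: chi_def zdot_add distrib_left exp_add)

lemma norm_chi [simp]: "norm (chi \<theta> x) = 1"
  by (simp add: chi_def)

lemma is_character_chi: "is_character (chi \<theta>)"
  by (simp add: is_character_def chi_add)

lemma continuous_on_chi [continuous_intros]: "continuous_on A (\<lambda>\<theta>. chi \<theta> q)"
  unfolding chi_def zdot_def by (intro continuous_intros)

section \<open>Orthogonality of characters and injectivity of the Fourier transform\<close>

lemma integral_exp_int: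
  fixes k :: int
  shows "(\<integral>t. indicator {-pi..pi} t *\<^sub>R exp (\<i> * complex_of_real (t * real_of_int k)) \<partial>lborel) =
    (if k = 0 then 2 * pi else 0)"
proof (cases "k = 0")
  case False
  define F where "F t = exp (\<i> * complex_of_real (t * real_of_int k)) / (\<i> * of_int k)" for t :: real
  have "(\<integral>t. indicator {-pi..pi} t *\<^sub>R exp (\<i> * complex_of_real (t * real_of_int k)) \<partial>lborel) = F pi - F (- pi)"
  proof (rule integral_FTC_atLeastAtMost)
    fix x
    have "((\<lambda>z. exp (\<i> * (z * of_int k)) / (\<i> * of_int k)) has_field_derivative exp (\<i> * (of_real x * of_int k))) (at (complex_of_real x))"
      using False by (auto intro!: derivative_eq_intros simp: ac_simps)
    from has_vector_derivative_real_field[OF this]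
    show "(F has_vector_derivative exp (\<i> * complex_of_real (x * real_of_int k))) (at x within {-pi..pi})"
      unfolding F_def by (simp add: comp_def)
  qed (auto intro!: continuous_intros)
  also have "exp (\<i> * complex_of_real (pi * real_of_int k)) = exp (\<i> * complex_of_real (- pi * real_of_int k))"
    by (subst exp_eq) (auto intro!: exI[of _ k] simp: algebra_simps)
  then have "F pi - F (- pi) = 0" by (simp add: F_def)
  finally show ?thesis using False by simp
qed (simp add: scaleR_conv_of_real)

abbreviation cube :: "(real^'n) set" where
  "cube \<equiv> cbox (- (\<chi> i. pi)) (\<chi> i. pi)"

lemma mem_cube: "\<theta> \<in> cube \<longleftrightarrow> (\<forall>b\<in>Basis. \<theta> \<bullet> b \<in> {-pi..pi})"
  by (auto simp: mem_box_cart Basis_vec_def inner_axis)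

lemma integral_chi:
  "(LINT \<theta>:cube|lborel. chi (\<theta> :: real^'n) q) = (if q = 0 then (2 * pi) ^ CARD('n) else 0)"
proof -
  define k :: "real^'n \<Rightarrow> int" where "k b = q $ axis_index b" for b
  define v :: "real^'n" where "v = (\<chi> i. real_of_int (q $ i))"
  have k: "v \<bullet> b = of_int (k b)" if "b \<in> Basis" for b
    using that by (auto simp: Basis_vec_def inner_axis v_def k_def axis_index_axis)
  have zdot: "zdot \<theta> q = (\<Sum>b\<in>Basis. (\<theta> \<bullet> b) * of_int (k b))" for \<theta> :: "real^'n"
  proof -
    have "zdot \<theta> q = \<theta> \<bullet> v" by (simp add: zdot_def inner_vec_def v_def)
    also have "\<dots> = (\<Sum>b\<in>Basis. (\<theta> \<bullet> b) * (v \<bullet> b))" by (rule euclidean_inner)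
    finally show ?thesis using k by simp
  qed
  define g where "g b t = indicator {-pi..pi} t *\<^sub>R exp (\<i> * complex_of_real (t * real_of_int (k b)))"
    for b :: "real^'n" and t :: real
  have prod: "indicator cube \<theta> *\<^sub>R chi \<theta> q = (\<Prod>b\<in>Basis. g b (\<theta> \<bullet> b))" for \<theta> :: "real^'n"
  proof -
    have "(\<Prod>b\<in>Basis. g b (\<theta> \<bullet> b)) = (\<Prod>b\<in>Basis. complex_of_real (indicator {-pi..pi} (\<theta> \<bullet> b))) *
        (\<Prod>b\<in>Basis. exp (\<i> * complex_of_real ((\<theta> \<bullet> b) * real_of_int (k b))))"
      by (simp add: g_def scaleR_conv_of_real prod.distrib)
    also have "(\<Prod>b\<in>Basis. exp (\<i> * complex_of_real ((\<theta> \<bullet> b) * real_of_int (k b)))) = chi \<theta> q"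
      by (simp add: chi_def zdot exp_sum sum_distrib_left)
    also have "(\<Prod>b\<in>Basis. complex_of_real (indicator {-pi..pi} (\<theta> \<bullet> b))) = of_real (indicator cube \<theta>)"
    proof (cases "\<theta> \<in> cube")
      case True
      then have "(\<Prod>b\<in>Basis. complex_of_real (indicator {-pi..pi} (\<theta> \<bullet> b))) = (\<Prod>b\<in>(Basis :: (real^'n) set). 1)"
        unfolding mem_cube by (intro prod.cong) auto
      then show ?thesis using True by simp
    next
      case False
      then obtain b :: "real^'n" where "b \<in> Basis" "\<theta> \<bullet> b \<notin> {-pi..pi}" unfolding mem_cube by blast
      then have "\<exists>b\<in>(Basis :: (real^'n) set). complex_of_real (indicator {-pi..pi} (\<theta> \<bullet> b)) = 0"
        by (intro bexI[of _ b]) auto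
      then have "(\<Prod>b\<in>Basis. complex_of_real (indicator {-pi..pi} (\<theta> \<bullet> b))) = 0"
        by (intro prod_zero) auto
      then show ?thesis using False by simp
    qed
    finally show ?thesis by (simp add: scaleR_conv_of_real)
  qed
  interpret product_sigma_finite "\<lambda>_ :: real^'n. lborel :: real measure"
    by standard
  have int: "integrable lborel (g b)" for b
    unfolding g_def by (intro borel_integrable_compact continuous_intros) auto
  have "(LINT \<theta>:cube|lborel. chi (\<theta> :: real^'n) q) =
      (\<integral>\<theta>. (\<Prod>b\<in>Basis. g b ((\<theta> :: real^'n) \<bullet> b)) \<partial>lborel)"
    unfolding set_lebesgue_integral_def prod ..
  also have "\<dots> = (\<integral>f. (\<Prod>b\<in>Basis. g b ((\<Sum>b\<in>Basis. f b *\<^sub>R b) \<bullet> b))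
      \<partial>(\<Pi>\<^sub>M b\<in>(Basis :: (real^'n) set). lborel))"
    by (subst lborel_eq, rule integral_distr) (use int in \<open>auto intro!: borel_measurable_prod simp: g_def\<close>)
  also have "\<dots> = (\<integral>f. (\<Prod>b\<in>Basis. g b (f b)) \<partial>(\<Pi>\<^sub>M b\<in>(Basis :: (real^'n) set). lborel))"
    by (simp add: inner_sum_left_Basis)
  also have "\<dots> = (\<Prod>b\<in>(Basis :: (real^'n) set). integral\<^sup>L lborel (g b))"
    by (rule product_integral_prod) (use int in auto)
  also have "\<dots> = (\<Prod>b\<in>(Basis :: (real^'n) set). if k b = 0 then 2 * pi else 0)"
    unfolding g_def integral_exp_int by simp
  also have "\<dots> = (if q = 0 then (2 * pi) ^ CARD('n) else 0)"
  proof (cases "q = 0")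
    case False
    then obtain i where "q $ i \<noteq> 0" by (auto simp: vec_eq_iff)
    then have "k (axis i 1) \<noteq> 0" by (simp add: k_def axis_index_axis)
    then have "\<exists>b\<in>(Basis :: (real^'n) set). k b \<noteq> 0"
      by (intro bexI[of _ "axis i 1"]) auto
    then show ?thesis using False by (auto simp: prod_zero_iff)
  qed (simp add: k_def)
  finally show ?thesis by simp
qed

text \<open>A finite partial sum equals minus the tail, hence is small uniformly in \<theta>, while
  integrating it against \<open>chi \<theta> (- q)\<close> extracts \<open>cf f q\<close>. Only
  finite sums are exchanged with the integral. The lemma transfers identities between symbols back
  to l^1.\<close>

lemma fourier_chi_injective:
  assumes "\<And>\<theta>. fourier (chi \<theta>) f = 0"
  shows "f = (0 :: (int^'n) l1)"
proof (rule l1_eqI)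
  fix q
  define V :: real where "V = (2 * pi) ^ CARD('n)"
  have V: "V > 0" by (simp add: V_def)
  have cube: "(LINT \<theta>:(cube :: (real^'n) set)|lborel. 1 :: complex) = V"
    using integral_chi[of "0 :: int^'n"] by (simp add: V_def)
  have "\<bar>cf f q\<bar> \<le> e" if "e > 0" for e
  proof -
    obtain F where F: "finite F" "dist (\<Sum>x\<in>F. \<bar>cf f x\<bar>) (norm f) \<le> e"
      using has_sum_finite_approximation[OF norm_l1_has_sum \<open>e > 0\<close>] by auto
    \<comment> \<open>Adding \<open>q\<close> keeps the coefficient to be extracted in the finite
      part; enlarging the set only shrinks the tail.\<close>
    define F' where "F' = insert q F"
    have F': "finite F'" "q \<in> F'" using F by (auto simp: F'_def)
    have tail: "(\<Sum>\<^sub>\<infinity>x\<in>-F'. \<bar>cf f x\<bar>) \<le> e"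
    proof -
      have "norm f = (\<Sum>\<^sub>\<infinity>x\<in>F'. \<bar>cf f x\<bar>) + (\<Sum>\<^sub>\<infinity>x\<in>-F'. \<bar>cf f x\<bar>)"
        unfolding norm_l1_def using infsum_Un_disjoint[OF cf_abs_summable cf_abs_summable, of F' "-F'" f]
        by simp
      moreover have "(\<Sum>x\<in>F. \<bar>cf f x\<bar>) \<le> (\<Sum>x\<in>F'. \<bar>cf f x\<bar>)"
        using F by (intro sum_mono2) (auto simp: F'_def)
      ultimately show ?thesis using F' F(2) by (simp add: dist_real_def)
    qed
    define T where "T \<theta> = (\<Sum>x\<in>F'. cf f x *\<^sub>R chi \<theta> x)" for \<theta> :: "real^'n"
    have T: "norm (T \<theta>) \<le> e" for \<theta>
    proof -
      have "fourier (chi \<theta>) f = (\<Sum>\<^sub>\<infinity>x\<in>F'. cf f x *\<^sub>R chi \<theta> x) + (\<Sum>\<^sub>\<infinity>x\<in>-F'. cf f x *\<^sub>R chi \<theta> x)"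
        unfolding fourier_def using fourier_summable[OF is_character_chi, of f \<theta>]
          infsum_Un_disjoint[of "\<lambda>x. cf f x *\<^sub>R chi \<theta> x" F' "-F'"] by simp
      then have "T \<theta> = - (\<Sum>\<^sub>\<infinity>x\<in>-F'. cf f x *\<^sub>R chi \<theta> x)"
        using assms[of \<theta>] F' by (simp add: T_def eq_neg_iff_add_eq_0)
      then have "norm (T \<theta>) = norm (\<Sum>\<^sub>\<infinity>x\<in>-F'. cf f x *\<^sub>R chi \<theta> x)" by simp
      also have "\<dots> \<le> (\<Sum>\<^sub>\<infinity>x\<in>-F'. \<bar>cf f x\<bar>)"
        by (rule norm_infsum_le[OF has_sum_infsum[OF fourier_summable[OF is_character_chi]]
              has_sum_infsum[OF cf_abs_summable]]) simp
      finally show ?thesis using tail by simp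
    qed
    have int: "set_integrable lborel cube (\<lambda>\<theta>. cf f x *\<^sub>R chi \<theta> (x - q))" for x
      unfolding set_integrable_def by (intro borel_integrable_compact continuous_intros) auto
    have "(LINT \<theta>:cube|lborel. T \<theta> * chi \<theta> (- q)) = (LINT \<theta>:cube|lborel. (\<Sum>x\<in>F'. cf f x *\<^sub>R chi \<theta> (x - q)))"
      by (simp add: T_def sum_distrib_right chi_add flip: uminus_add_conv_diff)
         (simp add: mult.commute chi_add)
    also have "\<dots> = (\<Sum>x\<in>F'. LINT \<theta>:cube|lborel. cf f x *\<^sub>R chi \<theta> (x - q))"
      using int F'(1) unfolding set_lebesgue_integral_def set_integrable_def
      by (simp add: scaleR_sum_right Bochner_Integration.integral_sum)
    also have "\<dots> = (\<Sum>x\<in>F'. cf f x *\<^sub>R (if x = q then V else 0))"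
      by (simp add: set_integral_scaleR_right integral_chi V_def power_mult_distrib cong: if_cong) (simp add: scaleR_conv_of_real)
    also have "\<dots> = of_real (cf f q * V)"
      using F' by (simp add: scaleR_conv_of_real if_distrib[of "\<lambda>x. _ * x"] cong: if_cong)
    finally have eq: "(LINT \<theta>:cube|lborel. T \<theta> * chi \<theta> (- q)) = of_real (cf f q * V)" .
    have "norm (LINT \<theta>:cube|lborel. T \<theta> * chi \<theta> (- q)) \<le> (LINT \<theta>:cube|lborel. norm (T \<theta> * chi \<theta> (- q)))"
      by (rule set_integral_norm_bound, unfold set_integrable_def T_def)
         (intro borel_integrable_compact continuous_intros, auto)
    also have "\<dots> \<le> (LINT \<theta>:(cube :: (real^'n) set)|lborel. e)"
    proof (rule set_integral_mono)
      show "set_integrable lborel cube (\<lambda>\<theta>. norm (T \<theta> * chi \<theta> (- q)))"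
        unfolding set_integrable_def T_def by (intro borel_integrable_compact continuous_intros) auto
      show "set_integrable lborel cube (\<lambda>\<theta>::real^'n. e)"
        unfolding set_integrable_def by (intro borel_integrable_compact continuous_intros) auto
    qed (simp add: norm_mult T)
    also have "\<dots> = e * V"
    proof -
      have "complex_of_real (LINT \<theta>:(cube :: (real^'n) set)|lborel. e) = complex_of_real (e * V)"
      proof -
        have "complex_of_real (LINT \<theta>:(cube :: (real^'n) set)|lborel. e) =
            (LINT \<theta>:(cube :: (real^'n) set)|lborel. complex_of_real e * 1)"
          by (simp add: set_integral_complex_of_real)
        also have "\<dots> = complex_of_real e * (LINT \<theta>:(cube :: (real^'n) set)|lborel. 1)"
          by (rule set_integral_mult_right)
        finally show ?thesis using cube by simp
      qed
      then show ?thesis by (simp only: of_real_eq_iff)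
    qed
    finally have "\<bar>cf f q * V\<bar> \<le> e * V"
      unfolding eq norm_of_real .
    then show ?thesis using V by (simp add: abs_mult)
  qed
  then have "\<bar>cf f q\<bar> \<le> 0" by (rule field_le_epsilon) simp
  then show "cf f q = cf 0 q" by simp
qed


section \<open>The simple random walk and its characteristic function\<close>

definition step :: "(int^'n) l1" where
  "step = (1 / (2 * real CARD('n))) *\<^sub>R (\<Sum>i\<in>UNIV. delta (unitz i) + delta (- unitz i))"

definition symbol :: "real^'n \<Rightarrow> real" where
  "symbol \<theta> = (1 / real CARD('n)) * (\<Sum>j\<in>UNIV. cos (\<theta> $ j))"

lemma cf_sum: "cf (\<Sum>i\<in>I. f i) x = (\<Sum>i\<in>I. cf (f i) x)"
  by (rule linear_sum[OF bounded_linear.linear[OF bounded_linear_cf]])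

lemma act_sum: "(\<And>x. \<bar>\<phi> x\<bar> \<le> B) \<Longrightarrow> act (\<Sum>i\<in>I. f i) \<phi> x = (\<Sum>i\<in>I. act (f i) \<phi> x)"
proof (induction I rule: infinite_finite_induct)
  case (insert i I)
  then show ?case by (simp add: act_add[where \<phi> = \<phi> and B = B])
qed (simp_all add: act_def)

lemma act_step:
  assumes "\<And>x. \<bar>\<phi> x\<bar> \<le> B"
  shows "act (step :: (int^'n) l1) \<phi> x =
    (1 / (2 * real CARD('n))) * (\<Sum>i\<in>UNIV. \<phi> (x - unitz i) + \<phi> (x + unitz i))"
  by (simp add: step_def act_scaleR act_sum[where \<phi> = \<phi>, OF assms] act_add[where \<phi> = \<phi>, OF assms] act_delta)

lemma cf_step_times:
  "cf (step * f) x = (1 / (2 * real CARD('n))) * (\<Sum>i\<in>UNIV. cf f (x - unitz i) + cf f (x + unitz i))"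
  for f :: "(int^'n) l1"
  unfolding cf_times by (rule act_step[OF abs_cf_le_norm])

lemma cf_step_power_nonneg: "cf (step ^ k) x \<ge> 0"
  by (induction k arbitrary: x) (auto simp: cf_one cf_step_times intro!: sum_nonneg divide_nonneg_nonneg)

lemma cf_step_power_minus: "cf (step ^ k) (- x) = cf (step ^ k) x"
proof (induction k arbitrary: x)
  case (Suc k)
  have "cf (step ^ k) (- x - unitz i) + cf (step ^ k) (- x + unitz i)
      = cf (step ^ k) (x - unitz i) + cf (step ^ k) (x + unitz i)" for i
    using Suc[of "x + unitz i"] Suc[of "x - unitz i"] by (simp add: algebra_simps)
  then show ?case by (simp add: cf_step_times)
qed (simp add: cf_one)

lemma fourier_step_chi:
  "fourier (chi \<theta>) (step :: (int^'n) l1) =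
    of_real (1 / (2 * real CARD('n))) * (\<Sum>i\<in>UNIV. chi \<theta> (unitz i) + chi \<theta> (- unitz i))"
proof -
  have lin: "linear (fourier (chi \<theta>))"
    by (rule bounded_linear.linear[OF bounded_linear_fourier[OF is_character_chi]])
  show ?thesis
    unfolding step_def linear_cmul[OF lin] linear_sum[OF lin] linear_add[OF lin]
      fourier_delta[OF is_character_chi] by (rule scaleR_conv_of_real)
qed

lemma fourier_step: "fourier (chi \<theta>) step = of_real (symbol \<theta>)"
proof -
  have "chi \<theta> (unitz i) + chi \<theta> (- unitz i) = of_real (2 * cos (\<theta> $ i))" for i
    by (simp add: chi_def zdot_minus zdot_unitz cos_of_real[symmetric] cos_exp_eq)
  then show ?thesis
    by (simp add: fourier_step_chi symbol_def sum_distrib_left[symmetric])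
qed

lemma continuous_on_symbol [continuous_intros]: "continuous_on A symbol"
  unfolding symbol_def by (intro continuous_intros)

lemma abs_symbol_le_one: "\<bar>symbol (\<theta> :: real^'n)\<bar> \<le> 1"
proof -
  have "\<bar>\<Sum>j\<in>UNIV. cos (\<theta> $ j)\<bar> \<le> (\<Sum>j\<in>UNIV. \<bar>cos (\<theta> $ j)\<bar>)" by (rule sum_abs)
  also have "\<dots> \<le> (\<Sum>j\<in>(UNIV :: 'n set). 1)" by (intro sum_mono) simp
  finally show ?thesis by (simp add: symbol_def abs_mult divide_le_eq)
qed

text \<open>Fourier inversion for the law of S_k. Multiplying by the symbol averages over the 2d
  neighbours of \<open>q\<close>, which is the recursion of the walk, so induction on
  \<open>k\<close> needs only finite sums of integrals.\<close>

lemma integral_symbol_power_chi: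
  "(LINT \<theta>:cube|lborel. of_real (symbol (\<theta> :: real^'n) ^ k) * chi \<theta> (- q)) =
    of_real ((2 * pi) ^ CARD('n) * cf (step ^ k) q)"
proof (induction k arbitrary: q)
  case 0
  then show ?case by (simp add: integral_chi cf_one)
next
  case (Suc k)
  define c where "c = complex_of_real (1 / (2 * real CARD('n)))"
  define G where "G \<theta> r = of_real (symbol (\<theta> :: real^'n) ^ k) * chi \<theta> (- r)" for \<theta> r
  have int: "set_integrable lborel cube (\<lambda>\<theta>. G \<theta> r)" for r
    unfolding set_integrable_def G_def by (intro borel_integrable_compact continuous_intros) auto
  have expand: "of_real (symbol \<theta> ^ Suc k) * chi \<theta> (- q) =
      c * (\<Sum>i\<in>UNIV. G \<theta> (q - unitz i) + G \<theta> (q + unitz i))" for \<theta>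
  proof -
    have "of_real (symbol \<theta> ^ Suc k) * chi \<theta> (- q) = fourier (chi \<theta>) step * G \<theta> q"
      by (simp add: G_def fourier_step)
    also have "fourier (chi \<theta>) step = c * (\<Sum>i\<in>UNIV. chi \<theta> (unitz i) + chi \<theta> (- unitz i))"
      by (simp add: fourier_step_chi c_def)
    also have "\<dots> * G \<theta> q = c * (\<Sum>i\<in>UNIV. G \<theta> (q - unitz i) + G \<theta> (q + unitz i))"
    proof -
      have "(chi \<theta> (unitz i) + chi \<theta> (- unitz i)) * G \<theta> q = G \<theta> (q - unitz i) + G \<theta> (q + unitz i)" for i
        using chi_add[of \<theta> "unitz i" "- q"] chi_add[of \<theta> "- unitz i" "- q"]
        by (simp add: G_def algebra_simps)
      then show ?thesis by (simp add: sum_distrib_right)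
    qed
    finally show ?thesis .
  qed
  have "(LINT \<theta>:cube|lborel. of_real (symbol (\<theta> :: real^'n) ^ Suc k) * chi \<theta> (- q)) =
      c * (\<Sum>i\<in>UNIV. (LINT \<theta>:cube|lborel. G \<theta> (q - unitz i)) + (LINT \<theta>:cube|lborel. G \<theta> (q + unitz i)))"
  proof -
    have "indicator cube \<theta> *\<^sub>R (c * (\<Sum>i\<in>UNIV. G \<theta> (q - unitz i) + G \<theta> (q + unitz i))) =
      c * (\<Sum>i\<in>UNIV. indicator cube \<theta> *\<^sub>R G \<theta> (q - unitz i) + indicator cube \<theta> *\<^sub>R G \<theta> (q + unitz i))"
      for \<theta>
      by (simp add: scaleR_add_right scaleR_sum_right flip: mult_scaleR_right)
    with expand int show ?thesis
      unfolding set_lebesgue_integral_def set_integrable_def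
      by (simp del: power_Suc of_real_power add: Bochner_Integration.integral_sum)
  qed
  also have "\<dots> = of_real ((2 * pi) ^ CARD('n) * cf (step ^ Suc k) q)"
  proof -
    have "(LINT \<theta>:cube|lborel. G \<theta> r) = of_real ((2 * pi) ^ CARD('n) * cf (step ^ k) r)" for r
      unfolding G_def by (rule Suc)
    then show ?thesis
      by (simp add: c_def cf_step_times sum_distrib_left distrib_left mult_ac)
  qed
  finally show ?case .
qed

text \<open>Equality forces |cos| = 1 in every coordinate, so it is enough to avoid, for a single
  coordinate \<open>j\<close>, the countably many hyperplanes on which it is a multiple of
  pi.\<close>

lemma AE_abs_symbol_less: "AE \<theta> in lborel. \<bar>symbol (\<theta> :: real^'n)\<bar> < 1"
proof -
  obtain j :: 'n where True by simp
  have "negligible (\<Union>i::int. {\<theta> :: real^'n. axis j 1 \<bullet> \<theta> = of_int i * pi})"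
    by (rule negligible_countable_Union) (auto simp: negligible_hyperplane axis_eq_0_iff)
  then have "AE \<theta> in lborel. \<theta> \<notin> (\<Union>i::int. {\<theta> :: real^'n. axis j 1 \<bullet> \<theta> = of_int i * pi})"
    by (auto simp: negligible_iff_null_sets AE_completion_iff dest!: AE_not_in)
  then show ?thesis
  proof eventually_elim
    case (elim \<theta>)
    then have "sin (\<theta> $ j) \<noteq> 0"
      by (auto simp: sin_zero_iff_int2 inner_axis')
    then have "\<bar>cos (\<theta> $ j)\<bar> \<noteq> 1"
      using sin_squared_eq[of "\<theta> $ j"] by (auto simp flip: abs_square_eq_1)
    then have j: "\<bar>cos (\<theta> $ j)\<bar> < 1" by (simp add: less_le)
    have "\<bar>\<Sum>j\<in>UNIV. cos (\<theta> $ j)\<bar> \<le> (\<Sum>j\<in>UNIV. \<bar>cos (\<theta> $ j)\<bar>)" by (rule sum_abs)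
    also have "\<dots> < (\<Sum>j\<in>(UNIV :: 'n set). 1)"
      by (rule sum_strict_mono_ex1) (use j in auto)
    finally show ?case by (simp add: symbol_def abs_mult divide_less_eq)
  qed
qed

text \<open>The logarithm is expanded in powers of the symbol and integrated term by term. This
  requires the integrals of |symbol|^k / k to be summable, and those with even \<open>k\<close> are
  return probabilities up to a constant; hence a hypothesis at 0 alone serves every
  \<open>q\<close>.\<close>

lemma Shat_eq:
  assumes "summable (\<lambda>k. cf (step ^ k) (0 :: int^'n) / real k)"
  shows "summable (\<lambda>k. cf (step ^ k) (q :: int^'n) / real k)"
    and "Shat q = - of_real (\<Sum>k. cf (step ^ k) q / real k)"
proof -
  define V where "V = (2 * pi) ^ CARD('n)"
  have V: "V > 0" by (simp add: V_def)
  define P where "P k = cf (step ^ k) (0 :: int^'n)" for k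
  have P: "P k \<ge> 0" for k by (simp add: P_def cf_step_power_nonneg)
  \<comment> \<open>The term \<open>k = 0\<close> is 0 because \<open>x / 0 = 0\<close>, so this is
    the logarithm series starting at 1; the same convention holds in all sums over \<open>k\<close>
    with this denominator.\<close>
  define f where "f k \<theta> = indicator cube \<theta> *\<^sub>R (of_real (- (symbol \<theta> ^ k) / real k) * chi \<theta> (- q))"
    for k and \<theta> :: "real^'n"
  have int: "integrable lborel (f k)" for k
  proof -
    have "integrable lborel (\<lambda>\<theta>. indicator cube \<theta> *\<^sub>R
        (of_real (- 1 / real k) * (of_real (symbol \<theta> ^ k) * chi \<theta> (- q))))"
      by (intro borel_integrable_compact continuous_intros) auto
    then show ?thesis by (simp add: f_def[abs_def])
  qed
  have AE: "AE \<theta> in lborel. summable (\<lambda>k. norm (f k \<theta>)) \<and>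
      (\<Sum>k. f k \<theta>) = indicator cube \<theta> *\<^sub>R (of_real (Sfun \<theta>) * chi \<theta> (- q))"
    using AE_abs_symbol_less
  proof eventually_elim
    case (elim \<theta>)
    have "(\<lambda>k. - (symbol \<theta> ^ k) / real k) sums ln (1 - symbol \<theta>)"
      using ln_series'[of "- symbol \<theta>"] elim by simp
    then have s: "(\<lambda>k. - (symbol \<theta> ^ k) / real k) sums Sfun \<theta>"
      by (simp add: Sfun_def symbol_def)
    have "(\<lambda>k. f k \<theta>) sums (indicator cube \<theta> *\<^sub>R (of_real (Sfun \<theta>) * chi \<theta> (- q)))"
      unfolding f_def by (intro sums_scaleR_right sums_mult2 sums_of_real s)
    moreover have "summable (\<lambda>k. norm (f k \<theta>))"
    proof (rule summable_comparison_test')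
      show "summable (\<lambda>k. \<bar>symbol \<theta>\<bar> ^ k)" using elim by (intro summable_geometric) simp
      fix k
      have "\<bar>symbol \<theta>\<bar> ^ k / real k \<le> \<bar>symbol \<theta>\<bar> ^ k"
        using divide_left_mono[of 1 "real k" "\<bar>symbol \<theta>\<bar> ^ k"] by (cases "k = 0") auto
      then show "norm (norm (f k \<theta>)) \<le> \<bar>symbol \<theta>\<bar> ^ k"
        by (auto simp: f_def indicator_def norm_mult norm_divide norm_power power_abs)
    qed
    ultimately show ?case by (simp add: sums_iff)
  qed
  define J where "J k = (LINT \<theta>:cube|lborel. \<bar>symbol (\<theta> :: real^'n)\<bar> ^ k)" for k
  have Jint: "set_integrable lborel cube (\<lambda>\<theta>::real^'n. \<bar>symbol \<theta>\<bar> ^ k)" for k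
    unfolding set_integrable_def by (intro borel_integrable_compact continuous_intros) auto
  \<comment> \<open>For even \<open>k\<close> the absolute value disappears and the integral is the
    Fourier coefficient at 0.\<close>
  have J_even: "J k = V * P k" if "even k" for k
  proof -
    have "complex_of_real (J k) = (LINT \<theta>:cube|lborel. of_real (symbol (\<theta> :: real^'n) ^ k) * chi \<theta> (- 0))"
      using that by (simp add: J_def set_integral_complex_of_real[symmetric] power_even_abs)
    also have "\<dots> = of_real (V * P k)"
      unfolding integral_symbol_power_chi by (simp add: V_def P_def)
    finally show ?thesis by (simp only: of_real_eq_iff)
  qed
  have J_mono: "J (Suc k) \<le> J k" for k
    unfolding J_def
  proof (rule set_integral_mono[OF Jint Jint])
    fix \<theta> :: "real^'n"
    show "\<bar>symbol \<theta>\<bar> ^ Suc k \<le> \<bar>symbol \<theta>\<bar> ^ k"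
      by (simp add: abs_symbol_le_one mult_left_le_one_le)
  qed
  \<comment> \<open>An odd power is bounded by the preceding even one. The indices start at 2, since
    index 1 would be compared with the term at 0, which is 0 by the division convention.\<close>
  have J_bound: "J (Suc (Suc k)) / real (Suc (Suc k)) \<le>
      V * (P (Suc (Suc k)) / real (Suc (Suc k)) + P (Suc k) / real (Suc k))" for k
  proof (cases "even k")
    case True
    then have "J (Suc (Suc k)) / real (Suc (Suc k)) = V * (P (Suc (Suc k)) / real (Suc (Suc k)))"
      by (simp add: J_even)
    moreover have "0 \<le> V * (P (Suc k) / real (Suc k))" using V P[of "Suc k"] by simp
    ultimately show ?thesis by (simp add: distrib_left)
  next
    case False
    have "J (Suc (Suc k)) / real (Suc (Suc k)) \<le> V * P (Suc k) / real (Suc (Suc k))"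
      using J_mono[of "Suc k"] J_even[of "Suc k"] False by (intro divide_right_mono) auto
    also have "\<dots> \<le> V * P (Suc k) / real (Suc k)"
      using V P[of "Suc k"] by (intro divide_left_mono) auto
    finally have "J (Suc (Suc k)) / real (Suc (Suc k)) \<le> V * (P (Suc k) / real (Suc k))" by simp
    moreover have "0 \<le> V * (P (Suc (Suc k)) / real (Suc (Suc k)))" using V P[of "Suc (Suc k)"] by simp
    ultimately show ?thesis by (simp add: distrib_left)
  qed
  have J_norm: "(\<integral>\<theta>. norm (f k \<theta>) \<partial>lborel) = J k / real k" for k
  proof -
    have "norm (f k \<theta>) = (indicator cube \<theta> *\<^sub>R \<bar>symbol \<theta>\<bar> ^ k) / real k" for \<theta>
      by (simp add: f_def norm_mult norm_divide norm_power)
    then show ?thesis by (simp add: J_def set_lebesgue_integral_def)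
  qed
  have sumJ: "summable (\<lambda>k. \<integral>\<theta>. norm (f k \<theta>) \<partial>lborel)"
    unfolding J_norm
  proof (subst summable_Suc_iff[symmetric], subst summable_Suc_iff[symmetric], rule summable_comparison_test')
    have s: "summable (\<lambda>k. P k / real k)" using assms by (simp add: P_def)
    from s have s1: "summable (\<lambda>k. P (Suc k) / real (Suc k))"
      by (subst (asm) summable_Suc_iff[symmetric])
    from s1 have s2: "summable (\<lambda>k. P (Suc (Suc k)) / real (Suc (Suc k)))"
      by (subst (asm) summable_Suc_iff[symmetric])
    from s1 s2 show "summable (\<lambda>k. V * (P (Suc (Suc k)) / real (Suc (Suc k)) + P (Suc k) / real (Suc k)))"
      by (intro summable_mult summable_add)
    have "J k \<ge> 0" for k
      unfolding J_def set_lebesgue_integral_def by (rule Bochner_Integration.integral_nonneg) simp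
    then show "norm (J (Suc (Suc k)) / real (Suc (Suc k))) \<le>
      V * (P (Suc (Suc k)) / real (Suc (Suc k)) + P (Suc k) / real (Suc k))" for k
      using J_bound[of k] by simp
  qed
  have "integral\<^sup>L lborel (f k) = - of_real (V * (cf (step ^ k) q / real k))" for k
  proof -
    have "f k = (\<lambda>\<theta>. (- 1 / of_nat k) * (indicator cube \<theta> *\<^sub>R (of_real (symbol \<theta> ^ k) * chi \<theta> (- q))))"
      by (simp add: f_def[abs_def])
    then have "integral\<^sup>L lborel (f k) = (- 1 / of_nat k) *
        (LINT \<theta>:cube|lborel. of_real (symbol (\<theta> :: real^'n) ^ k) * chi \<theta> (- q))"
      unfolding set_lebesgue_integral_def by (simp only: integral_mult_right_zero)
    then show ?thesis unfolding integral_symbol_power_chi by (simp add: V_def)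
  qed
  moreover have "(\<lambda>k. integral\<^sup>L lborel (f k)) sums (\<integral>\<theta>. (\<Sum>k. f k \<theta>) \<partial>lborel)"
    by (rule sums_integral[OF int _ sumJ]) (use AE in auto)
  moreover have "(\<integral>\<theta>. (\<Sum>k. f k \<theta>) \<partial>lborel) = (LINT \<theta>:cube|lborel. of_real (Sfun \<theta>) * chi \<theta> (- q))"
    unfolding set_lebesgue_integral_def
  proof (rule integral_cong_AE)
    have [measurable]: "f k \<in> borel_measurable lborel" for k
      using int[of k] by (rule borel_measurable_integrable)
    show "(\<lambda>\<theta>. \<Sum>k. f k \<theta>) \<in> borel_measurable lborel" by measurable
    have [measurable]: "symbol \<in> borel_measurable borel" "(\<lambda>\<theta>. chi \<theta> (- q)) \<in> borel_measurable borel"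
      by (intro borel_measurable_continuous_onI continuous_intros)+
    have "(\<lambda>\<theta> :: real^'n. ln (1 - symbol \<theta>)) \<in> borel_measurable borel" by measurable
    then have [measurable]: "(Sfun :: real^'n \<Rightarrow> real) \<in> borel_measurable borel"
      by (simp add: Sfun_def[abs_def] symbol_def)
    show "(\<lambda>\<theta>. indicator cube \<theta> *\<^sub>R (of_real (Sfun \<theta>) * chi \<theta> (- q))) \<in> borel_measurable lborel"
      by measurable
    show "AE \<theta> in lborel. (\<Sum>k. f k \<theta>) = indicator cube \<theta> *\<^sub>R (of_real (Sfun \<theta>) * chi \<theta> (- q))"
      using AE by auto
  qed
  ultimately have sums: "(\<lambda>k. - complex_of_real (V * (cf (step ^ k) q / real k))) sums
      (LINT \<theta>:cube|lborel. of_real (Sfun \<theta>) * chi \<theta> (- q))"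
    by simp
  then have "(\<lambda>k. (- 1 / of_real V) * - complex_of_real (V * (cf (step ^ k) q / real k))) sums
      ((- 1 / of_real V) * (LINT \<theta>:cube|lborel. of_real (Sfun \<theta>) * chi \<theta> (- q)))"
    by (rule sums_mult)
  moreover have "(- 1 / of_real V) * - complex_of_real (V * (cf (step ^ k) q / real k)) =
      of_real (cf (step ^ k) q / real k)" for k
    using V by simp
  moreover have "(- 1 / of_real V) * (LINT \<theta>:cube|lborel. of_real (Sfun \<theta>) * chi \<theta> (- q)) = - Shat q"
    by (simp add: Shat_def chi_def zdot_minus V_def power_int_minus divide_inverse)
  ultimately have *: "(\<lambda>k. complex_of_real (cf (step ^ k) q / real k)) sums (- Shat q)"
    by (simp only:)
  show s: "summable (\<lambda>k. cf (step ^ k) q / real k)"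
    using sums_summable[OF *] by (simp only: summable_of_real_iff)
  then show "Shat q = - of_real (\<Sum>k. cf (step ^ k) q / real k)"
    using sums_unique2[OF * sums_of_real[OF summable_sums[OF s]]] by (metis minus_minus)
qed

section \<open>The half-space problem\<close>

lemma abs_zdot_unitz_le: "\<bar>zdot p (unitz i)\<bar> \<le> norm p"
  by (simp add: zdot_unitz component_le_norm_cart)

lemma zdot_neighbour:
  shows "zdot p x - norm p \<le> zdot p (x + unitz i)" "zdot p x - norm p \<le> zdot p (x - unitz i)"
    "zdot p (x + unitz i) \<le> zdot p x + norm p" "zdot p (x - unitz i) \<le> zdot p x + norm p"
  using abs_zdot_unitz_le[of p i] by (auto simp: zdot_add zdot_diff)

lemma dlap_zdot: "dlap (zdot p) x = 0"
  by (simp add: dlap_def zdot_add zdot_diff)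

lemma dlap_zdot_square: "dlap (\<lambda>x. (zdot p x)\<^sup>2) x = 2 * (norm p)\<^sup>2"
proof -
  have "dlap (\<lambda>x. (zdot p x)\<^sup>2) x = (\<Sum>i\<in>UNIV. 2 * (p $ i)\<^sup>2)"
    unfolding dlap_def by (intro sum.cong) (auto simp: zdot_add zdot_diff zdot_unitz power2_eq_square algebra_simps)
  also have "\<dots> = 2 * (norm p)\<^sup>2"
    unfolding power2_norm_eq_inner inner_vec_def by (simp add: power2_eq_square sum_distrib_left)
  finally show ?thesis .
qed

lemma dlap_add: "dlap (\<lambda>x. u x + v x) x = dlap u x + dlap v x"
  by (simp add: dlap_def sum.distrib[symmetric] algebra_simps)

lemma dlap_diff: "dlap (\<lambda>x. u x - v x) x = dlap u x - dlap v x"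
  by (simp add: dlap_def sum_subtractf[symmetric] algebra_simps)

lemma dlap_mult: "dlap (\<lambda>x. c * u x) x = c * dlap u x"
  by (simp add: dlap_def sum_distrib_left algebra_simps)

lemma dlap_const: "dlap (\<lambda>x. c) x = 0"
  by (simp add: dlap_def)

lemma dlap_le:
  fixes u :: "int^'n \<Rightarrow> real"
  assumes "\<And>i. u (x + unitz i) \<le> S" "\<And>i. u (x - unitz i) \<le> S"
  shows "dlap u x \<le> 2 * real CARD('n) * (S - u x)"
proof -
  have "dlap u x \<le> (\<Sum>i\<in>(UNIV :: 'n set). S + S - 2 * u x)"
    unfolding dlap_def by (intro sum_mono diff_right_mono add_mono assms)
  then show ?thesis by (simp add: algebra_simps)
qed

text \<open>The strip may be unbounded along the hyperplane, so \<open>w\<close> need not attain its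
  supremum. Adding a small multiple of (p.x)^2, bounded on the strip and with Laplacian a positive
  constant, makes a near-maximum contradictory already.\<close>

lemma strip_maximum_principle:
  fixes p :: "real^'n" and w :: "int^'n \<Rightarrow> real"
  assumes p: "p \<noteq> 0"
    and bdd: "\<And>x. 0 < zdot p x \<Longrightarrow> zdot p x < R \<Longrightarrow> w x \<le> B"
    and sub: "\<And>x. 0 < zdot p x \<Longrightarrow> zdot p x < R \<Longrightarrow> dlap w x \<ge> 0"
    and bdry: "\<And>x. - norm p \<le> zdot p x \<Longrightarrow> zdot p x \<le> R + norm p \<Longrightarrow>
      \<not> (0 < zdot p x \<and> zdot p x < R) \<Longrightarrow> w x \<le> 0"
    and x0: "0 < zdot p x0" "zdot p x0 < R"
  shows "w x0 \<le> 0"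
proof (rule ccontr)
  assume "\<not> w x0 \<le> 0"
  then have pos: "w x0 > 0" by simp
  have Rp: "R + norm p > 0" using x0 by (intro add_pos_nonneg) auto
  \<comment> \<open>Chosen so that the quadratic term is at most \<open>w x0\<close> on the strip
    and on the layer reached by one step; boundary values of the perturbed function then stay below
    its supremum.\<close>
  define \<epsilon> where "\<epsilon> = w x0 / (R + norm p)\<^sup>2"
  have \<epsilon>: "\<epsilon> > 0" "\<epsilon> * (R + norm p)\<^sup>2 = w x0"
    using pos Rp by (simp_all add: \<epsilon>_def)
  define z where "z x = w x + \<epsilon> * (zdot p x)\<^sup>2" for x
  define X where "X = {x. 0 < zdot p x \<and> zdot p x < R}"
  have x0X: "x0 \<in> X" using x0 by (simp add: X_def)
  have sq: "\<epsilon> * (zdot p x)\<^sup>2 \<le> w x0" if "- norm p \<le> zdot p x" "zdot p x \<le> R + norm p" for x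
  proof -
    have "\<bar>zdot p x\<bar> \<le> R + norm p" using that x0 by auto
    then have "(zdot p x)\<^sup>2 \<le> (R + norm p)\<^sup>2"
      using abs_le_square_iff[of "zdot p x" "R + norm p"] Rp by simp
    then have "\<epsilon> * (zdot p x)\<^sup>2 \<le> \<epsilon> * (R + norm p)\<^sup>2" using \<epsilon>(1) by (intro mult_left_mono) auto
    then show ?thesis using \<epsilon>(2) by simp
  qed
  have "z x \<le> B + w x0" if "x \<in> X" for x
  proof -
    have x: "0 < zdot p x" "zdot p x < R" using that by (simp_all add: X_def)
    then have "- norm p \<le> zdot p x" "zdot p x \<le> R + norm p"
      using norm_ge_zero[of p] by linarith+
    then show ?thesis using bdd[OF x] sq[of x] by (simp add: z_def)
  qed
  then have bdd_z: "bdd_above (z ` X)" by (auto simp: bdd_above_def)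
  define S where "S = (SUP x\<in>X. z x)"
  have S: "z x \<le> S" if "x \<in> X" for x
    unfolding S_def using bdd_z that by (rule cSUP_upper2) simp
  have "w x0 \<le> z x0" using \<epsilon>(1) by (simp add: z_def)
  then have Sw: "w x0 \<le> S" using S[OF x0X] by simp
  \<comment> \<open>At a point within \<delta> of the supremum the Laplacian is less than
    2d\<delta>, which is exactly the Laplacian 2\<epsilon>|p|^2 of the quadratic term.\<close>
  define \<delta> where "\<delta> = \<epsilon> * (norm p)\<^sup>2 / real CARD('n)"
  have \<delta>: "\<delta> > 0" using \<epsilon> p by (simp add: \<delta>_def)
  obtain x where x: "x \<in> X" "S - \<delta> < z x"
    using less_cSUP_iff[OF _ bdd_z, of "S - \<delta>"] x0X \<delta> by (auto simp: S_def)
  have nb: "z y \<le> S" if "- norm p \<le> zdot p y" "zdot p y \<le> R + norm p" for y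
  proof (cases "y \<in> X")
    case False
    then have "w y \<le> 0" using bdry[of y] that by (auto simp: X_def)
    then show ?thesis using sq[OF that] Sw by (simp add: z_def)
  qed (rule S)
  have "0 < zdot p x" "zdot p x < R" using x(1) by (simp_all add: X_def)
  then have "z (x + unitz i) \<le> S" "z (x - unitz i) \<le> S" for i
    using zdot_neighbour[of p x i] by - (rule nb; linarith)+
  then have "dlap z x \<le> 2 * real CARD('n) * (S - z x)"
    by (rule dlap_le)
  also have "\<dots> < 2 * real CARD('n) * \<delta>"
    using x(2) by (intro mult_strict_left_mono) auto
  also have "\<dots> = \<epsilon> * (2 * (norm p)\<^sup>2)"
    by (simp add: \<delta>_def)
  also have "\<dots> \<le> dlap z x"
    using sub[of x] x(1) by (simp add: z_def[abs_def] dlap_add dlap_mult dlap_zdot_square X_def)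
  finally show False by simp
qed

text \<open>The difference is bounded by some C; on the strip 0 < p.x < R it is compared with the
  linear barrier (C / R)(p.x + |p|), which tends to 0 at a fixed point as R grows. Exchanging
  \<open>u\<close> and \<open>v\<close> gives uniqueness.\<close>

lemma halfspace_sol_le:
  fixes p :: "real^'n"
  assumes p: "p \<noteq> 0" and u: "is_halfspace_sol p u" and v: "is_halfspace_sol p v"
  shows "u x \<le> v x"
proof (cases "zdot p x > 0")
  case False
  then show ?thesis using u v by (simp add: is_halfspace_sol_def)
next
  case x: True
  obtain Cu Cv where Cu: "\<And>x. zdot p x > 0 \<Longrightarrow> \<bar>u x - zdot p x\<bar> \<le> Cu"
    and Cv: "\<And>x. zdot p x > 0 \<Longrightarrow> \<bar>v x - zdot p x\<bar> \<le> Cv"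
    using u v unfolding is_halfspace_sol_def by blast
  define C where "C = Cu + Cv"
  define w where "w x = u x - v x" for x
  have w: "w y \<le> C" if "zdot p y > 0" for y
    using Cu[OF that] Cv[OF that] by (simp add: w_def C_def abs_le_iff)
  have C0: "C \<ge> 0" using Cu[OF x] Cv[OF x] by (simp add: C_def)
  \<comment> \<open>The shift by \<open>norm p\<close> keeps the barrier nonnegative on the layer
    just below the hyperplane that neighbours can reach; for p.x >= R the barrier is at least
    C.\<close>
  have bound: "w x \<le> C / R * (zdot p x + norm p)" if R: "zdot p x < R" for R
  proof -
    have R0: "R > 0" using R x by simp
    have CR: "C / R \<ge> 0" using C0 R0 by simp
    have "w x - C / R * (zdot p x + norm p) \<le> 0"
    proof (rule strip_maximum_principle[OF p])
      fix y assume y: "0 < zdot p y" "zdot p y < R"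
      have "0 \<le> C / R * (zdot p y + norm p)" using y CR by (intro mult_nonneg_nonneg) auto
      then show "w y - C / R * (zdot p y + norm p) \<le> C" using w[OF y(1)] by simp
      show "dlap (\<lambda>y. w y - C / R * (zdot p y + norm p)) y \<ge> 0"
        using u v y unfolding w_def dlap_diff dlap_mult dlap_add dlap_const dlap_zdot
        by (simp add: is_halfspace_sol_def)
    next
      fix y assume y: "- norm p \<le> zdot p y" "\<not> (0 < zdot p y \<and> zdot p y < R)"
      show "w y - C / R * (zdot p y + norm p) \<le> 0"
      proof (cases "0 < zdot p y")
        case False
        then have "w y = 0" using u v by (simp add: w_def is_halfspace_sol_def)
        moreover have "0 \<le> C / R * (zdot p y + norm p)" using y CR by (intro mult_nonneg_nonneg) auto
        ultimately show ?thesis by simp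
      next
        case True
        have "C = C / R * R" using R0 by simp
        also have "\<dots> \<le> C / R * (zdot p y + norm p)"
          using y True CR by (intro mult_left_mono) (auto intro: add_increasing2)
        finally show ?thesis using w[OF True] by simp
      qed
    qed (use x R in auto)
    then show ?thesis by simp
  qed
  have "w x \<le> 0"
  proof (rule ccontr)
    assume "\<not> w x \<le> 0"
    then have wx: "w x > 0" by simp
    define K where "K = C * (zdot p x + norm p)"
    have K: "K \<ge> 0" using C0 x by (simp add: K_def)
    \<comment> \<open>Large enough that \<open>x\<close> lies in the strip and
      \<open>K / R < w x\<close>.\<close>
    define R where "R = zdot p x + K / w x + 1"
    have "K / w x \<ge> 0" using K wx by simp
    then have R: "R > zdot p x" "R > 0" "K / w x < R" using x unfolding R_def by linarith+
    have "w x \<le> K / R" using bound[OF R(1)] by (simp add: K_def)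
    then have "w x * R \<le> K" using R by (simp add: le_divide_eq)
    moreover have "K < w x * R" using R(3) wx by (simp add: divide_less_eq mult.commute)
    ultimately show False by simp
  qed
  then show ?thesis by (simp add: w_def)
qed

text \<open>The unknown is V = u - p.x, harmonic above the hyperplane and equal to -p.x below it.
  The averaging operator \<open>T\<close> is iterated from a supersolution: one step from the upper
  side reaches only values of at most |p|, so the constant |p| does not increase. The iterates
  decrease and stay nonnegative, and \<open>T\<close> involves finitely many values at each point,
  so it passes to the limit. Nonnegativity of V also gives u >= p.x, hence positivity above.\<close>

lemma ex_halfspace_sol:
  fixes p :: "real^'n"
  shows "\<exists>u. is_halfspace_sol p u \<and> (\<forall>x. zdot p x > 0 \<longrightarrow> u x > 0)"
proof -
  define T where "T v x = (if zdot p x > 0 then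
      (\<Sum>i\<in>UNIV. v (x + unitz i) + v (x - unitz i)) / (2 * real CARD('n)) else - zdot p x)"
    for v :: "int^'n \<Rightarrow> real" and x
  define v where "v n = (T ^^ n) (\<lambda>x. if zdot p x > 0 then norm p else - zdot p x)" for n
  have T_mono: "T f x \<le> T g x" if "\<And>x. f x \<le> g x" for f g x
    using that by (auto simp: T_def intro!: divide_right_mono sum_mono add_mono)
  have v_Suc: "v (Suc n) = T (v n)" for n by (simp add: v_def)
  have v0: "v 0 x = (if zdot p x > 0 then norm p else - zdot p x)" for x by (simp add: v_def)
  have v0_le: "v 0 y \<le> norm p" if "- norm p \<le> zdot p y" for y using that by (auto simp: v0)
  have dec: "v (Suc n) x \<le> v n x" for n x
  proof (induction n arbitrary: x)
    case 0
    show ?case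
    proof (cases "zdot p x > 0")
      case True
      have "v 0 (x + unitz i) \<le> norm p" "v 0 (x - unitz i) \<le> norm p" for i
        using zdot_neighbour[of p x i] True by - (rule v0_le, linarith)+
      then have "(\<Sum>i\<in>UNIV. v 0 (x + unitz i) + v 0 (x - unitz i)) \<le> (\<Sum>i\<in>(UNIV :: 'n set). norm p + norm p)"
        by (intro sum_mono add_mono) auto
      then show ?thesis using True by (simp add: v_Suc T_def v0 divide_le_eq mult_ac)
    qed (simp add: v_Suc T_def v0)
  next
    case (Suc n)
    show ?case using T_mono[of "v (Suc n)" "v n"] Suc by (simp add: v_Suc)
  qed
  have nonneg: "v n x \<ge> 0" for n x
    by (induction n arbitrary: x) (auto simp: v0 v_Suc T_def intro!: divide_nonneg_nonneg sum_nonneg add_nonneg_nonneg)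
  have "\<exists>l. (\<lambda>n. v n x) \<longlonglongrightarrow> l" for x
    using decseq_convergent[of "\<lambda>n. v n x" 0] dec nonneg by (metis decseq_SucI)
  then obtain V where V: "\<And>x. (\<lambda>n. v n x) \<longlonglongrightarrow> V x" by metis
  have V_fix: "V x = T V x" for x
  proof -
    have "(\<lambda>n. T (v n) x) \<longlonglongrightarrow> T V x"
      unfolding T_def by (cases "zdot p x > 0") (auto intro!: tendsto_intros V)
    moreover have "(\<lambda>n. T (v n) x) \<longlonglongrightarrow> V x"
      using LIMSEQ_Suc[OF V[of x]] by (simp add: v_Suc)
    ultimately show ?thesis using LIMSEQ_unique by blast
  qed
  have V_nonneg: "V x \<ge> 0" for x
    by (rule LIMSEQ_le_const[OF V]) (use nonneg in blast)
  have V_le: "V x \<le> v 0 x" for x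
    by (rule LIMSEQ_le_const2[OF V]) (use dec decseqD[OF decseq_SucI[of "\<lambda>n. v n x"], of 0] in blast)
  define u where "u x = zdot p x + V x" for x
  have "is_halfspace_sol p u"
    unfolding is_halfspace_sol_def
  proof (intro conjI allI impI exI[of _ "norm p"])
    fix x assume x: "zdot p x > 0"
    have "dlap u x = dlap V x"
      unfolding u_def dlap_add dlap_zdot by simp
    also have "\<dots> = (\<Sum>i\<in>UNIV. V (x + unitz i) + V (x - unitz i)) - 2 * real CARD('n) * V x"
      by (simp add: dlap_def sum_subtractf)
    also have "\<dots> = 0" using V_fix[of x] x by (simp add: T_def)
    finally show "dlap u x = 0" .
    show "\<bar>u x - zdot p x\<bar> \<le> norm p"
      using V_nonneg[of x] V_le[of x] x by (simp add: u_def v0)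
  next
    fix x assume "zdot p x \<le> 0"
    then show "u x = 0" using V_fix[of x] by (simp add: u_def T_def)
  qed
  moreover have "u x > 0" if "zdot p x > 0" for x
    using that V_nonneg[of x] by (simp add: u_def)
  ultimately show ?thesis by blast
qed

lemma usol_properties:
  assumes "p \<noteq> 0"
  shows "is_halfspace_sol p (usol p)" and "zdot p x > 0 \<Longrightarrow> usol p x > 0"
proof -
  obtain u where u: "is_halfspace_sol p u" "\<forall>x. zdot p x > 0 \<longrightarrow> u x > 0"
    using ex_halfspace_sol by blast
  have "usol p = u"
    unfolding usol_def
  proof (rule the_equality)
    show "is_halfspace_sol p u" by (rule u(1))
    fix v assume "is_halfspace_sol p v"
    then show "v = u" using halfspace_sol_le[OF assms] u(1) by (intro ext antisym) auto
  qed
  then show "is_halfspace_sol p (usol p)" and "zdot p x > 0 \<Longrightarrow> usol p x > 0" using u by auto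
qed

section \<open>Wiener-Hopf factorisation\<close>

lemma is_character_one: "is_character (\<lambda>_. 1 :: real)"
  by (simp add: is_character_def)

abbreviation mass :: "'a::ab_group_add l1 \<Rightarrow> real" where
  "mass \<equiv> fourier (\<lambda>_. 1)"

lemma mass_def: "mass f = infsum (cf f) UNIV"
  by (simp add: fourier_def)

lemmas mass_times = fourier_times[OF is_character_one]
  and mass_exp = fourier_exp[OF is_character_one]
  and mass_one = fourier_one[OF is_character_one]
  and mass_delta = fourier_delta[OF is_character_one]
  and linear_mass = bounded_linear.linear[OF bounded_linear_fourier[OF is_character_one]]

lemmas mass_linear = linear_add[OF linear_mass] linear_diff[OF linear_mass]
  linear_cmul[OF linear_mass] linear_sum[OF linear_mass] linear_0[OF linear_mass] linear_neg[OF linear_mass]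

lemma abs_mass_le_norm: "\<bar>mass f\<bar> \<le> norm f"
proof -
  have "norm (mass f) \<le> norm f"
    unfolding mass_def by (rule norm_infsum_le[OF has_sum_infsum[OF cf_summable] norm_l1_has_sum]) simp
  then show ?thesis by simp
qed

lemma mass_nonneg: "(\<And>x. cf f x \<ge> 0) \<Longrightarrow> mass f \<ge> 0"
  unfolding mass_def by (rule infsum_nonneg)

lemma norm_eq_mass: "(\<And>x. cf f x \<ge> 0) \<Longrightarrow> norm f = mass f"
  unfolding mass_def norm_l1_def by (intro infsum_cong) simp

lemma mass_step: "mass (step :: (int^'n) l1) = 1"
  by (simp add: step_def mass_linear mass_delta)

lemma norm_step: "norm (step :: (int^'n) l1) = 1"
proof -
  have "cf (step :: (int^'n) l1) x \<ge> 0" for x using cf_step_power_nonneg[of 1 x] by simp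
  then show ?thesis using norm_eq_mass mass_step by metis
qed

section \<open>The logarithm of 1 - s step\<close>

definition logser :: "real \<Rightarrow> (int^'n) l1" where
  "logser s = - (\<Sum>k. (s ^ k / real k) *\<^sub>R step ^ k)"

context
  fixes s :: real
  assumes s: "0 < s" "s < 1"
begin

lemma summable_logser: "summable (\<lambda>k. (s ^ k / real k) *\<^sub>R (step :: (int^'n) l1) ^ k)"
proof (rule summable_comparison_test')
  show "summable (\<lambda>k. s ^ k)" using s by (intro summable_geometric) simp
  fix k
  have "norm ((step :: (int^'n) l1) ^ k) \<le> 1"
    using norm_power_ineq[of "step :: (int^'n) l1" k] by (simp add: norm_step)
  then have "norm ((s ^ k / real k) *\<^sub>R (step :: (int^'n) l1) ^ k) \<le> s ^ k / real k"
    using s mult_left_mono[of _ 1 "s ^ k / real k"] by simp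
  also have "\<dots> \<le> s ^ k"
    using divide_left_mono[of 1 "real k" "s ^ k"] s by (cases "k = 0") auto
  finally show "norm ((s ^ k / real k) *\<^sub>R (step :: (int^'n) l1) ^ k) \<le> s ^ k" .
qed

lemma logser_bounded_linear:
  assumes "bounded_linear T"
  shows "(\<lambda>k. - ((s ^ k / real k) *\<^sub>R T ((step :: (int^'n) l1) ^ k))) sums T (logser s)"
proof -
  have "(\<lambda>k. T (- ((s ^ k / real k) *\<^sub>R (step :: (int^'n) l1) ^ k))) sums T (logser s)"
    unfolding logser_def
    by (intro bounded_linear.sums[OF assms] sums_minus summable_sums summable_logser)
  then show ?thesis
    by (simp only: linear_neg[OF bounded_linear.linear[OF assms]] linear_cmul[OF bounded_linear.linear[OF assms]])
qed

lemma cf_logser_sums: "(\<lambda>k. s ^ k / real k * cf (step ^ k) q) sums (- cf (logser s) q)"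
  using sums_minus[OF logser_bounded_linear[OF bounded_linear_cf[of q]]] by simp

lemma cf_logser_nonpos: "cf (logser s) q \<le> 0"
proof -
  have "0 \<le> - cf (logser s) q"
    by (rule sums_le[OF _ sums_zero cf_logser_sums]) (use s in \<open>simp add: cf_step_power_nonneg\<close>)
  then show ?thesis by simp
qed

lemma cf_logser_minus: "cf (logser s) (- q) = cf (logser s) q"
  using sums_unique2[OF cf_logser_sums[of q] cf_logser_sums[of "- q", unfolded cf_step_power_minus]] by simp

text \<open>\<open>fourier (chi \<theta>)\<close> is a continuous homomorphism and commutes with
  \<open>exp\<close>, so the identity reduces to exp (ln (1 - x)) = 1 - x at x = s
  \<open>symbol \<theta>\<close>; injectivity of the Fourier transform lifts it to l^1.\<close>

lemma exp_logser: "exp (logser s) = 1 - s *\<^sub>R (step :: (int^'n) l1)"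
proof -
  have "exp (logser s) - (1 - s *\<^sub>R (step :: (int^'n) l1)) = 0"
  proof (rule fourier_chi_injective)
    fix \<theta> :: "real^'n"
    define x where "x = s * symbol \<theta>"
    have x: "\<bar>x\<bar> < 1"
    proof -
      have "\<bar>x\<bar> \<le> s * 1" unfolding x_def abs_mult using s abs_symbol_le_one[of \<theta>] by (intro mult_mono) auto
      then show ?thesis using s by simp
    qed
    note lin = bounded_linear_fourier[OF is_character_chi, of \<theta>]
    have "(\<lambda>k. complex_of_real (- (x ^ k) / real k)) sums of_real (ln (1 - x))"
      using ln_series'[of "- x"] x by (intro sums_of_real) simp
    moreover have "(\<lambda>k. complex_of_real (- (x ^ k) / real k)) sums fourier (chi \<theta>) (logser s)"
      using logser_bounded_linear[OF lin]
      by (simp add: fourier_power[OF is_character_chi] fourier_step x_def scaleR_conv_of_real power_mult_distrib)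
    ultimately have "fourier (chi \<theta>) (logser s) = of_real (ln (1 - x))"
      using sums_unique2 by blast
    then have "fourier (chi \<theta>) (exp (logser s)) = of_real (1 - x)"
      using x by (simp add: fourier_exp[OF is_character_chi] exp_of_real)
    moreover have "fourier (chi \<theta>) (s *\<^sub>R step) = of_real x"
      unfolding linear_cmul[OF bounded_linear.linear[OF lin]] fourier_step
      by (simp add: x_def scaleR_conv_of_real)
    ultimately show "fourier (chi \<theta>) (exp (logser s) - (1 - s *\<^sub>R (step :: (int^'n) l1))) = 0"
      by (simp only: linear_diff[OF bounded_linear.linear[OF lin]] fourier_one[OF is_character_chi]) simp
  qed
  then show ?thesis by simp
qed

end

text \<open>The part below the hyperplane is \<open>log_up (- p) s\<close>, so every fact about the
  upper factor covers the lower one as well.\<close>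

definition log_up :: "real^'n \<Rightarrow> real \<Rightarrow> (int^'n) l1" where
  "log_up p s = restr {x. zdot p x > 0} (logser s)"

definition log_level :: "real^'n \<Rightarrow> real \<Rightarrow> (int^'n) l1" where
  "log_level p s = restr (Lam p) (logser s)"

lemma zdot_uminus: "zdot (- p) x = - zdot p x"
  by (simp add: zdot_def sum_negf)

lemma logser_split: "logser s = log_up p s + log_level p s + log_up (- p) s"
  by (rule l1_eqI) (auto simp: log_up_def log_level_def restr.rep_eq Lam_def zdot_uminus)

lemma exp_add_l1: "exp (f + g) = exp f * exp g" for f g :: "'a::ab_group_add l1"
  by (rule exp_add_commuting) (rule mult.commute)

lemma exp_minus_l1: "exp (- f) * exp f = 1" for f :: "'a::ab_group_add l1"
  using exp_minus_inverse[of f] by (simp add: mult.commute)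

lemma cf_exp_up:
  assumes "supp_in f {x. zdot p x > 0}"
  shows "x \<noteq> 0 \<Longrightarrow> zdot p x \<le> 0 \<Longrightarrow> cf (exp f) x = 0" and "cf (exp f) 0 = 1"
proof -
  have "supp_in (exp f - 1) {x. zdot p x > 0}"
    by (rule supp_in_exp_minus_one[OF assms]) (simp add: zdot_add)
  then have *: "cf (exp f - 1) x = 0" if "zdot p x \<le> 0" for x
    using that by (auto dest!: supp_inD[of _ _ x])
  show "x \<noteq> 0 \<Longrightarrow> zdot p x \<le> 0 \<Longrightarrow> cf (exp f) x = 0" using *[of x] by (simp add: cf_one)
  show "cf (exp f) 0 = 1" using *[of 0] by (simp add: cf_one)
qed

lemma supp_in_exp:
  assumes "supp_in f C" "\<And>c d. c \<in> C \<Longrightarrow> d \<in> C \<Longrightarrow> c + d \<in> C" "0 \<in> C"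
  shows "supp_in (exp f) C"
proof -
  have "supp_in (exp f - 1) C" using assms(1,2) by (rule supp_in_exp_minus_one)
  then show ?thesis using assms(3) by (auto simp: supp_in_def cf_one split: if_splits)
qed

lemma supp_in_log_up: "supp_in (log_up p s) {x. zdot p x > 0}"
  by (simp add: log_up_def supp_in_restr)

lemma supp_in_minus: "supp_in f C \<Longrightarrow> supp_in (- f) C"
  by (simp add: supp_in_def)

lemma supp_in_add: "supp_in f C \<Longrightarrow> supp_in g C \<Longrightarrow> supp_in (f + g) C"
  by (simp add: supp_in_def)

lemma supp_in_exp_log_level: "supp_in (exp (log_level p s)) (Lam p)"
  by (rule supp_in_exp) (auto simp: log_level_def supp_in_restr Lam_def zdot_add)

context
  fixes s :: real
  assumes s: "0 < s" "s < 1"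
begin

lemma cf_log_up_nonpos: "cf (log_up p s) x \<le> 0"
  by (simp add: log_up_def restr.rep_eq cf_logser_nonpos[OF s])

lemma cf_log_level_nonpos: "cf (log_level p s) x \<le> 0"
  by (simp add: log_level_def restr.rep_eq cf_logser_nonpos[OF s])

lemma exp_up_times:
  "exp (log_up p s) = (1 - s *\<^sub>R step) * exp (- (log_level p s + log_up (- p) s))"
  by (simp add: exp_logser[OF s, symmetric] logser_split[of s p] exp_add_l1[symmetric])

text \<open>Left multiplication by \<open>1 - s step\<close> reaches only one step upwards, and
  \<open>exp (- (log_level + log_up (- p)))\<close> lives on the closed lower half-space.\<close>

lemma cf_exp_log_up:
  shows "x \<noteq> 0 \<Longrightarrow> cf (exp (log_up p s)) x \<le> 0"
    and "norm p < zdot p x \<Longrightarrow> cf (exp (log_up p s)) x = 0"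
proof -
  define g where "g = exp (- (log_level p s + log_up (- p) s))"
  \<comment> \<open>The exponent is nonnegative because the coefficients of the logarithm are
    nonpositive; this fixes the sign of the upper factor away from 0.\<close>
  have g_nonneg: "cf g y \<ge> 0" for y
    unfolding g_def
  proof (rule cf_exp_nonneg)
    show "0 \<le> cf (- (log_level p s + log_up (- p) s)) x" for x
      using cf_log_up_nonpos[of "- p" x] cf_log_level_nonpos[of p x] by simp
  qed
  have "supp_in (log_up (- p) s) {x. zdot p x \<le> 0}"
    by (rule supp_in_mono[OF supp_in_log_up]) (auto simp: zdot_uminus)
  moreover have "supp_in (log_level p s) {x. zdot p x \<le> 0}"
    unfolding log_level_def by (rule supp_in_mono[OF supp_in_restr]) (auto simp: Lam_def)
  ultimately have "supp_in g {x. zdot p x \<le> 0}"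
    unfolding g_def by (intro supp_in_exp supp_in_minus supp_in_add) (auto simp: zdot_add)
  then have g0: "cf g y = 0" if "zdot p y > 0" for y using that by (auto dest!: supp_inD[of _ _ y])
  have up: "cf (exp (log_up p s)) x = - s * cf (step * g) x" if "zdot p x > 0" for x
    unfolding exp_up_times g_def[symmetric] using g0[OF that] by (simp add: left_diff_distrib)
  have nonneg: "cf (step * g) x \<ge> 0" for x
    unfolding cf_step_times by (auto intro!: divide_nonneg_nonneg sum_nonneg simp: g_nonneg)
  show "x \<noteq> 0 \<Longrightarrow> cf (exp (log_up p s)) x \<le> 0"
    using up[of x] nonneg[of x] s cf_exp_up(1)[OF supp_in_log_up, of x p s]
    by (cases "zdot p x > 0") (auto simp: mult_nonneg_nonneg)
  assume x: "norm p < zdot p x"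
  then have "zdot p x > 0" using norm_ge_zero[of p] by linarith
  have "zdot p (x - unitz i) > 0" "zdot p (x + unitz i) > 0" for i
    using zdot_neighbour[of p x i] x by linarith+
  then have "cf (step * g) x = 0" by (simp add: cf_step_times g0)
  then show "cf (exp (log_up p s)) x = 0" using up[OF \<open>zdot p x > 0\<close>] by simp
qed

lemma mass_exp_bounds:
  "0 < mass (exp (log_up p s))" "mass (exp (log_up p s)) \<le> 1"
  "0 < mass (exp (log_level p s))" "mass (exp (log_level p s)) \<le> 1"
  using mass_nonneg[of "- log_up p s"] mass_nonneg[of "- log_level p s"]
  by (simp_all add: mass_exp mass_linear cf_log_up_nonpos cf_log_level_nonpos)

text \<open>The coefficient at 0 is 1 and all others are nonpositive, so the norm is 2 minus the
  mass. The bound is uniform in \<open>s\<close>, although the logarithm itself is not bounded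
  uniformly.\<close>

lemma norm_exp_log_up: "norm (exp (log_up p s)) \<le> 2"
proof -
  have "\<bar>cf (exp (log_up p s)) x\<bar> = cf (2 *\<^sub>R 1 - exp (log_up p s)) x" for x
    using cf_exp_log_up(1)[of x p] cf_exp_up(2)[OF supp_in_log_up, of p s] by (cases "x = 0") (auto simp: cf_one)
  then have "norm (exp (log_up p s)) = mass (2 *\<^sub>R 1 - exp (log_up p s))"
    unfolding norm_l1_def mass_def by (intro infsum_cong) simp
  also have "\<dots> = 2 - mass (exp (log_up p s))" by (simp only: mass_linear mass_one) simp
  finally show ?thesis using mass_exp_bounds(1)[of p] by simp
qed

lemma supp_in_exp_log_up: "supp_in (exp (log_up p s)) {x. 0 \<le> zdot p x \<and> zdot p x \<le> norm p}"
  unfolding supp_in_def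
proof (intro allI impI)
  fix x assume "x \<notin> {x. 0 \<le> zdot p x \<and> zdot p x \<le> norm p}"
  then have "zdot p x < 0 \<or> norm p < zdot p x" by force
  then show "cf (exp (log_up p s)) x = 0"
    using cf_exp_log_up(2)[of p x] cf_exp_up(1)[OF supp_in_log_up, of x p s] by (cases "x = 0") auto
qed

text \<open>Reflection symmetry of the walk: upper and lower factor have the same mass, so the
  factorisation at trivial character becomes e^2 e0 = 1 - s.\<close>

lemma mass_log_up_uminus: "mass (log_up (- p) s) = mass (log_up p s)"
proof -
  have "bij (uminus :: int^'n \<Rightarrow> int^'n)" by (simp add: bij_uminus)
  from infsum_reindex_bij_betw[OF this, of "cf (log_up (- p) s)"]
  show ?thesis
    by (simp add: mass_def log_up_def restr.rep_eq zdot_uminus zdot_minus cf_logser_minus[OF s] cong: if_cong)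
qed

lemma wiener_hopf:
  "exp (log_up p s) * exp (log_level p s) * exp (log_up (- p) s) = 1 - s *\<^sub>R step"
  by (simp add: exp_logser[OF s, symmetric] logser_split[of s p] exp_add_l1)

lemma mass_wiener_hopf:
  "(mass (exp (log_up p s)))\<^sup>2 * mass (exp (log_level p s)) = 1 - s"
  "mass (exp (log_up (- p) s)) = mass (exp (log_up p s))"
proof -
  show eq: "mass (exp (log_up (- p) s)) = mass (exp (log_up p s))"
    by (simp add: mass_exp mass_log_up_uminus)
  have "mass (1 - s *\<^sub>R (step :: (int^'n) l1)) = 1 - s"
    by (simp only: mass_linear mass_one mass_step) simp
  then have "mass (exp (log_up p s) * exp (log_level p s) * exp (log_up (- p) s)) = 1 - s"
    by (simp only: wiener_hopf)
  then show "(mass (exp (log_up p s)))\<^sup>2 * mass (exp (log_level p s)) = 1 - s"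
    by (simp add: mass_times eq power2_eq_square mult_ac)
qed

end

section \<open>First and second moments of the factors\<close>

lemma ex_weighted:
  assumes "supp_in f {x. \<bar>w x\<bar> \<le> R}"
  obtains f' where "\<And>x. cf f' x = w x * cf f x" "norm f' \<le> R * norm f" "supp_in f' {x. \<bar>w x\<bar> \<le> R}"
proof -
  have le: "\<bar>w x * cf f x\<bar> \<le> R * \<bar>cf f x\<bar>" for x
    using assms by (cases "\<bar>w x\<bar> \<le> R") (auto simp: supp_in_def abs_mult intro!: mult_right_mono)
  obtain f' where f': "\<And>x. cf f' x = w x * cf f x"
    using ex_l1_dominated[OF cf_abs_summable[of f] le] by metis
  have "norm f' \<le> R * norm f"
    by (rule has_sum_mono[OF norm_l1_has_sum has_sum_cmult_right[OF norm_l1_has_sum]]) (simp add: f' le)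
  moreover have "supp_in f' {x. \<bar>w x\<bar> \<le> R}" using assms by (simp add: supp_in_def f')
  ultimately show ?thesis using f' that by blast
qed

text \<open>The derivation with weight p.x is applied twice to a b c = 1 - s step. The first moment
  of the right side is 0 by symmetry, so the first moments of a and c are opposite; the cross terms
  of the second order then give -2 e0 m^2. The remainder \<kappa> adds the second moments of a and
  c, each at most 2|p|^2 since the norms are at most 2 and the supports lie in |p.x| <= |p|.\<close>

lemma first_second_moment:
  fixes p :: "real^'n"
  assumes s: "0 < s" "s < 1"
  obtains a' \<kappa> where "\<And>x. cf a' x = zdot p x * cf (exp (log_up p s)) x"
    "norm a' \<le> 2 * norm p" "\<bar>\<kappa>\<bar> \<le> 4 * (norm p)\<^sup>2"
    "2 * mass (exp (log_level p s)) * (mass a')\<^sup>2 =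
      s * (norm p)\<^sup>2 / real CARD('n) + mass (exp (log_up p s)) * mass (exp (log_level p s)) * \<kappa>"
proof -
  define a b c where "a = exp (log_up p s)" and "b = exp (log_level p s)" and "c = exp (log_up (- p) s)"
  have supp: "supp_in a {x. \<bar>zdot p x\<bar> \<le> norm p}" "supp_in c {x. \<bar>zdot p x\<bar> \<le> norm p}"
    unfolding a_def c_def using supp_in_exp_log_up[OF s, of p] supp_in_exp_log_up[OF s, of "- p"]
    by (auto elim!: supp_in_mono simp: zdot_uminus)
  obtain a' where a': "\<And>x. cf a' x = zdot p x * cf a x" "norm a' \<le> norm p * norm a"
      "supp_in a' {x. \<bar>zdot p x\<bar> \<le> norm p}"
    by (rule ex_weighted[OF supp(1)]) blast
  obtain c' where c': "\<And>x. cf c' x = zdot p x * cf c x" "norm c' \<le> norm p * norm c"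
      "supp_in c' {x. \<bar>zdot p x\<bar> \<le> norm p}"
    by (rule ex_weighted[OF supp(2)]) blast
  obtain a'' where a'': "\<And>x. cf a'' x = zdot p x * cf a' x" "norm a'' \<le> norm p * norm a'"
    by (rule ex_weighted[OF a'(3)]) blast
  obtain c'' where c'': "\<And>x. cf c'' x = zdot p x * cf c' x" "norm c'' \<le> norm p * norm c'"
    by (rule ex_weighted[OF c'(3)]) blast
  note leib = leibniz[where w = "zdot p", OF zdot_add]
  \<comment> \<open>The middle factor lives where the weight vanishes, so its derivative is
    0.\<close>
  have b': "cf 0 x = zdot p x * cf b x" for x
    using supp_in_exp_log_level[of p s] by (auto simp: supp_in_def b_def Lam_def)
  define A' where "A' = a' * b * c + a * b * c'"
  define A'' where "A'' = (a'' * b * c + a' * b * c') + (a' * b * c' + a * b * c'')"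
  have ab: "cf (a' * b) x = zdot p x * cf (a * b) x" "cf (a'' * b) x = zdot p x * cf (a' * b) x" for x
    using leib[OF a'(1) b', of x] leib[OF a''(1) b', of x] by simp_all
  have A': "cf A' x = zdot p x * cf (a * b * c) x" for x
    unfolding A'_def by (rule leib[OF ab(1) c'(1)])
  have A'': "cf A'' x = (zdot p x)\<^sup>2 * cf (a * b * c) x" for x
  proof -
    have "cf A'' x = zdot p x * cf (a' * b * c) x + zdot p x * cf (a * b * c') x"
      unfolding A''_def plus_l1.rep_eq[of "_ + _"]
      by (intro arg_cong2[where f = "(+)"] leib[OF ab(2) c'(1)] leib[OF ab(1) c''(1)])
    also have "\<dots> = zdot p x * cf A' x" by (simp only: A'_def plus_l1.rep_eq distrib_left)
    finally show ?thesis by (simp only: A' power2_eq_square mult.assoc)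
  qed
  have abc: "a * b * c = 1 - s *\<^sub>R step"
    unfolding a_def b_def c_def by (rule wiener_hopf[OF s])
  define k where "k = 1 / (2 * real CARD('n))"
  \<comment> \<open>\<open>step'\<close> and \<open>step''\<close> are the weighted versions of
    \<open>step\<close>, written with point masses so that their total masses can be read off: 0 and
    |p|^2 / d.\<close>
  define step' where "step' = k *\<^sub>R (\<Sum>i\<in>UNIV. p $ i *\<^sub>R delta (unitz i) - p $ i *\<^sub>R delta (- unitz i))"
  define step'' where "step'' = k *\<^sub>R (\<Sum>i\<in>UNIV. (p $ i)\<^sup>2 *\<^sub>R delta (unitz i) + (p $ i)\<^sup>2 *\<^sub>R delta (- unitz i))"
  have cf_step: "cf step x = k * (\<Sum>i\<in>UNIV. cf (delta (unitz i)) x + cf (delta (- unitz i)) x)" for x :: "int^'n"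
    by (simp add: step_def cf_sum k_def)
  have delta: "p $ i * cf (delta (unitz i)) x = zdot p x * cf (delta (unitz i)) x"
    "p $ i * cf (delta (- unitz i)) x = - (zdot p x * cf (delta (- unitz i)) x)"
    "(p $ i)\<^sup>2 * cf (delta (unitz i)) x = (zdot p x)\<^sup>2 * cf (delta (unitz i)) x"
    "(p $ i)\<^sup>2 * cf (delta (- unitz i)) x = (zdot p x)\<^sup>2 * cf (delta (- unitz i)) x" for i x
    by (auto simp: delta.rep_eq zdot_unitz zdot_minus)
  have "cf step' x = k * (\<Sum>i\<in>UNIV. zdot p x * (cf (delta (unitz i)) x + cf (delta (- unitz i)) x))" for x
    by (simp add: step'_def cf_sum delta distrib_left)
  then have "cf step' x = zdot p x * cf step x" for x
    by (simp add: cf_step sum_distrib_left[symmetric])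
  moreover have zdot_one: "zdot p x * cf 1 x = 0" for x by (simp add: cf_one)
  ultimately have "A' = - s *\<^sub>R step'"
    by (intro l1_eqI) (simp add: A' abc right_diff_distrib)
  then have tA': "mass A' = 0"
    by (simp add: mass_linear step'_def mass_delta)
  have "cf step'' x = k * (\<Sum>i\<in>UNIV. (zdot p x)\<^sup>2 * (cf (delta (unitz i)) x + cf (delta (- unitz i)) x))" for x
    by (simp add: step''_def cf_sum delta distrib_left)
  then have "cf step'' x = (zdot p x)\<^sup>2 * cf step x" for x
    by (simp add: cf_step sum_distrib_left[symmetric])
  moreover have "(zdot p x)\<^sup>2 * cf 1 x = 0" for x by (simp add: cf_one)
  ultimately have "A'' = - s *\<^sub>R step''"
    by (intro l1_eqI) (simp add: A'' abc right_diff_distrib)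
  moreover have "(\<Sum>i\<in>UNIV. (p $ i)\<^sup>2) = (norm p)\<^sup>2"
    unfolding power2_norm_eq_inner inner_vec_def by (simp add: power2_eq_square)
  ultimately have tA'': "mass A'' = - (s * (norm p)\<^sup>2 / real CARD('n))"
    by (simp add: mass_linear step''_def mass_delta k_def sum.distrib)
  define e e0 where "e = mass a" and "e0 = mass b"
  have e: "e > 0" "e0 > 0" "mass c = e"
    using mass_exp_bounds[OF s, of p] mass_wiener_hopf(2)[OF s, of p] by (simp_all add: e_def e0_def a_def b_def c_def)
  have "e * e0 * (mass a' + mass c') = 0"
    using tA' e(3) by (simp add: A'_def mass_linear mass_times e_def e0_def algebra_simps)
  then have c'_mass: "mass c' = - mass a'" using e by simp
  define \<kappa> where "\<kappa> = mass a'' + mass c''"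
  have main: "2 * e0 * (mass a')\<^sup>2 = s * (norm p)\<^sup>2 / real CARD('n) + e * e0 * \<kappa>"
  proof -
    have "mass A'' = (mass a'' * e0 * e + mass a' * e0 * mass c') + (mass a' * e0 * mass c' + e * e0 * mass c'')"
      unfolding A''_def mass_linear mass_times e(3) e_def[symmetric] e0_def[symmetric] ..
    then show ?thesis
      unfolding tA'' c'_mass \<kappa>_def by (simp add: algebra_simps power2_eq_square)
  qed
  have ac: "norm a \<le> 2" "norm c \<le> 2" unfolding a_def c_def by (rule norm_exp_log_up[OF s])+
  have a'_le: "norm a' \<le> 2 * norm p" "norm c' \<le> 2 * norm p"
    using a'(2) c'(2) mult_left_mono[OF ac(1), of "norm p"] mult_left_mono[OF ac(2), of "norm p"] by simp_all
  have "norm a'' \<le> 2 * (norm p)\<^sup>2" "norm c'' \<le> 2 * (norm p)\<^sup>2"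
    using a''(2) c''(2) mult_left_mono[OF a'_le(1), of "norm p"] mult_left_mono[OF a'_le(2), of "norm p"]
    by (simp_all add: power2_eq_square)
  then have "\<bar>\<kappa>\<bar> \<le> 4 * (norm p)\<^sup>2"
    using abs_mass_le_norm[of a''] abs_mass_le_norm[of c''] by (simp add: \<kappa>_def abs_le_iff)
  then show ?thesis using that[of a' \<kappa>] a'(1) a'_le(1) main unfolding a_def e_def e0_def b_def by blast
qed

section \<open>Passage to the limit\<close>

text \<open>\<open>u x - zdot p x\<close> grows linearly below the hyperplane; only its values one step below matter, so it
  is cut off there.\<close>

definition corrector :: "real^'n \<Rightarrow> (int^'n \<Rightarrow> real) \<Rightarrow> int^'n \<Rightarrow> real" where
  "corrector p u x = (if - norm p \<le> zdot p x then u x - zdot p x else 0)"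

lemma corrector_bounded:
  assumes "is_halfspace_sol p u"
  obtains C where "C \<ge> 0" "\<And>x. \<bar>corrector p u x\<bar> \<le> C"
proof -
  obtain C where C: "\<And>x. zdot p x > 0 \<Longrightarrow> \<bar>u x - zdot p x\<bar> \<le> C" and u0: "\<And>x. zdot p x \<le> 0 \<Longrightarrow> u x = 0"
    using assms unfolding is_halfspace_sol_def by blast
  have "\<bar>corrector p u x\<bar> \<le> \<bar>C\<bar> + norm p" for x
  proof (cases "zdot p x > 0")
    case True
    then have "\<bar>corrector p u x\<bar> \<le> \<bar>C\<bar>" using C[of x] by (auto simp: corrector_def)
    then show ?thesis using norm_ge_zero[of p] by linarith
  qed (use u0[of x] in \<open>auto simp: corrector_def\<close>)
  then show ?thesis using that[of "\<bar>C\<bar> + norm p"] by simp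
qed

text \<open>Subtracting the harmonic function p.x does not change the Laplacian, and for p.x >= 0
  all neighbours lie above the cut-off.\<close>

lemma step_act_corrector:
  fixes p :: "real^'n"
  assumes "\<And>x. \<bar>corrector p u x\<bar> \<le> C" "0 \<le> zdot p x"
  shows "act (1 - s *\<^sub>R step) (corrector p u) x =
    (1 - s) * corrector p u x - s * (dlap u x / (2 * real CARD('n)))"
proof -
  have nb: "- norm p \<le> zdot p (x - unitz i)" "- norm p \<le> zdot p (x + unitz i)" for i
    using zdot_neighbour[of p x i] assms(2) by linarith+
  have x: "corrector p u x = u x - zdot p x"
  proof -
    have "- norm p \<le> zdot p x" using assms(2) norm_ge_zero[of p] by linarith
    then show ?thesis by (simp add: corrector_def)
  qed
  have nbv: "corrector p u (x - unitz i) = u (x - unitz i) - (zdot p x - zdot p (unitz i))"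
    "corrector p u (x + unitz i) = u (x + unitz i) - (zdot p x + zdot p (unitz i))" for i
    using nb[of i] by (simp_all add: corrector_def flip: zdot_add zdot_diff)
  have "(\<Sum>i\<in>UNIV. corrector p u (x - unitz i) + corrector p u (x + unitz i)) =
      (\<Sum>i\<in>(UNIV :: 'n set). (u (x + unitz i) + u (x - unitz i) - 2 * u x) + 2 * corrector p u x)"
    by (intro sum.cong) (simp_all add: nbv x)
  also have "\<dots> = dlap u x + 2 * real CARD('n) * corrector p u x"
    by (simp add: sum.distrib dlap_def)
  finally have "act step (corrector p u) x = corrector p u x + dlap u x / (2 * real CARD('n))"
    by (simp add: act_step[OF assms(1)] add_divide_distrib)
  moreover have "act (1 - s *\<^sub>R step) (corrector p u) x = corrector p u x - s * act step (corrector p u) x"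
  proof -
    have "act (1 + (- s) *\<^sub>R step) (corrector p u) x = corrector p u x + (- s) * act step (corrector p u) x"
      by (simp only: act_add[OF assms(1)] act_scaleR) (simp add: one_l1_def act_delta)
    then show ?thesis by simp
  qed
  ultimately show ?thesis by (simp add: algebra_simps)
qed

text \<open>Both sides of a b = c^(-1) (1 - s step) act on the corrector at 0. The left side only
  sees points -y with 0 <= p.y <= |p|, where the corrector is p.y; this yields the first moment of a
  b, that is e0 m. On the right, apart from the factor 1 - s, only the Laplacian at 0 survives. The
  error is at most (1 - s) C times the norm of c^(-1); this norm is 1 / e by positivity, and 1 - s =
  e^2 e0.\<close>

lemma boundary_identity:
  fixes p :: "real^'n"
  assumes s: "0 < s" "s < 1" and u: "is_halfspace_sol p u"
    and C: "\<And>x. \<bar>corrector p u x\<bar> \<le> C"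
    and a': "\<And>x. cf a' x = zdot p x * cf (exp (log_up p s)) x"
  shows "\<bar>mass (exp (log_level p s)) * mass a' + s * (dlap u 0 / (2 * real CARD('n)))\<bar>
    \<le> C * (mass (exp (log_up p s)) * mass (exp (log_level p s)))"
proof -
  define v where "v = corrector p u"
  define N where "N = dlap u 0 / (2 * real CARD('n))"
  define a b c g where "a = exp (log_up p s)" and "b = exp (log_level p s)"
    and "c = exp (log_up (- p) s)" and "g = exp (- log_up (- p) s)"
  note e = mass_exp_bounds[OF s, of p] mass_wiener_hopf[OF s, of p]
  have gc: "g * c = 1" unfolding g_def c_def by (rule exp_minus_l1)
  have ab: "a * b = g * (1 - s *\<^sub>R step)"
  proof -
    have "g * (1 - s *\<^sub>R step) = g * (a * b * c)"
      unfolding a_def b_def c_def wiener_hopf[OF s] ..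
    also have "\<dots> = (g * c) * (a * b)" by (simp only: mult_ac)
    finally show ?thesis by (simp add: gc)
  qed
  have C0: "C \<ge> 0" using C[of 0] by linarith
  have Cv: "\<bar>v x\<bar> \<le> C" for x unfolding v_def by (rule C)
  \<comment> \<open>The inverse of c vanishes at all nonzero points of the hyperplane. There
    \<open>u\<close> need not be harmonic, so this is what isolates \<open>dlap u 0\<close>;
    dividing by b as well would lose it.\<close>
  have g_supp: "cf g y = 0" if "y \<noteq> 0" "\<not> zdot p y < 0" for y
    unfolding g_def using cf_exp_up(1)[OF supp_in_minus[OF supp_in_log_up], of y "- p" s] that
    by (simp add: zdot_uminus)
  have g_0: "cf g 0 = 1"
    unfolding g_def by (rule cf_exp_up(2)[OF supp_in_minus[OF supp_in_log_up]])
  have g_nonneg: "cf g y \<ge> 0" for y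
    unfolding g_def by (rule cf_exp_nonneg) (simp add: cf_log_up_nonpos[OF s])
  have "mass g * mass c = 1" by (simp add: gc mass_one flip: mass_times)
  then have norm_g: "norm g = 1 / mass a"
    using e by (simp add: norm_eq_mass[OF g_nonneg] a_def c_def divide_eq_eq eq_divide_eq)
  have v0: "v 0 = 0" using u norm_ge_zero[of p] by (simp add: v_def corrector_def is_halfspace_sol_def)
  have "act (a * b) v 0 = act g (act (1 - s *\<^sub>R step) v) 0"
    unfolding ab by (rule act_times[OF Cv])
  also have "\<dots> = (\<Sum>\<^sub>\<infinity>y. (1 - s) * (cf g y * v (0 - y)) + - s * N * cf 1 y)"
    unfolding act_def[of g]
  proof (rule infsum_cong)
    fix y
    show "cf g y * act (1 - s *\<^sub>R step) v (0 - y) = (1 - s) * (cf g y * v (0 - y)) + - s * N * cf 1 y"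
    proof (cases "y = 0 \<or> zdot p y < 0")
      case True
      then have "act (1 - s *\<^sub>R step) v (0 - y) = (1 - s) * v (0 - y) - s * (dlap u (0 - y) / (2 * real CARD('n)))"
        unfolding v_def by (intro step_act_corrector[OF C]) (auto simp: zdot_minus)
      moreover have "dlap u (0 - y) = 0" if "y \<noteq> 0"
        using u that True by (simp add: is_halfspace_sol_def zdot_minus)
      ultimately show ?thesis
        by (cases "y = 0") (simp_all add: cf_one g_0 N_def)
    qed (simp add: g_supp cf_one)
  qed
  also have "\<dots> = (1 - s) * act g v 0 - s * N"
  proof -
    have "(\<Sum>\<^sub>\<infinity>y. (1 - s) * (cf g y * v (0 - y)) + - s * N * cf 1 y) =
        (\<Sum>\<^sub>\<infinity>y. (1 - s) * (cf g y * v (0 - y))) + (\<Sum>\<^sub>\<infinity>y :: int^'n. - s * N * cf 1 y)"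
    proof (rule infsum_add)
      show "(\<lambda>y. (1 - s) * (cf g y * v (0 - y))) summable_on UNIV"
        by (rule summable_on_cmult_right[OF act_summable[where \<phi> = v, OF Cv]])
      show "(\<lambda>y. - s * N * cf 1 y) summable_on (UNIV :: (int^'n) set)"
        by (rule summable_on_cmult_right[OF cf_summable])
    qed
    moreover have "(\<Sum>\<^sub>\<infinity>y :: int^'n. - s * N * cf 1 y) = - s * N * mass (1 :: (int^'n) l1)"
      by (simp only: mass_def infsum_cmult_right')
    ultimately show ?thesis
      by (simp add: infsum_cmult_right' act_def mass_one)
  qed
  finally have "act (a * b) v 0 = (1 - s) * act g v 0 - s * N" .
  moreover have "act (a * b) v 0 = mass a' * mass b"
  proof -
    \<comment> \<open>On the support of a b the point -y lies in the uncut layer below the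
      hyperplane, where \<open>u\<close> is 0 and \<open>v (0 - y)\<close> is
      \<open>zdot p y\<close>.\<close>
    have "cf (a * b) y * v (0 - y) = cf (a' * b) y" for y
    proof -
      have "cf 0 x = zdot p x * cf b x" for x
        using supp_in_exp_log_level[of p s] by (auto simp: supp_in_def b_def Lam_def)
      from leibniz[where w = "zdot p", OF zdot_add a'[folded a_def] this, of y]
      have D: "cf (a' * b) y = zdot p y * cf (a * b) y" by simp
      have "supp_in (a * b) {x. 0 \<le> zdot p x \<and> zdot p x \<le> norm p}"
        unfolding a_def b_def
        by (rule supp_in_times[OF supp_in_exp_log_up[OF s] supp_in_exp_log_level]) (simp add: zdot_add Lam_def)
      then have "cf (a * b) y = 0 \<or> 0 \<le> zdot p y \<and> zdot p y \<le> norm p"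
        by (auto simp: supp_in_def)
      then show ?thesis
        using u by (auto simp: D v_def corrector_def is_halfspace_sol_def zdot_minus)
    qed
    then have "act (a * b) v 0 = mass (a' * b)" by (simp add: act_def mass_def)
    then show ?thesis by (simp add: mass_times)
  qed
  ultimately have "mass b * mass a' + s * N = (1 - s) * act g v 0" by (simp add: mult.commute)
  then have "\<bar>mass b * mass a' + s * N\<bar> = (1 - s) * \<bar>act g v 0\<bar>" using s by (simp add: abs_mult)
  also have "\<dots> \<le> (1 - s) * (norm g * C)" using s by (intro mult_left_mono act_bound Cv) auto
  also have "\<dots> = C * (mass a * mass b)"
    using e(1) unfolding norm_g e(5)[symmetric] a_def b_def by (simp add: power2_eq_square)
  finally show ?thesis unfolding a_def b_def N_def .
qed

text \<open>The weights are at most 1, which bounds the sums from above; from below a finite subsum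
  close to the full sum is kept, and there the limit is taken termwise.\<close>

lemma infsum_weighted_tendsto:
  fixes g :: "'a \<Rightarrow> real"
  assumes g: "g summable_on A" "\<And>x. x \<in> A \<Longrightarrow> g x \<ge> 0"
    and w: "\<And>n x. 0 \<le> w n x" "\<And>n x. w n x \<le> 1" "\<And>x. (\<lambda>n. w n x) \<longlonglongrightarrow> 1"
  shows "(\<lambda>n. infsum (\<lambda>x. w n x * g x) A) \<longlonglongrightarrow> infsum g A"
proof (rule order_tendstoI)
  have le: "w n x * g x \<le> g x" if "x \<in> A" for n x
    using mult_right_mono[OF w(2) g(2)[OF that], of n x] by simp
  have sum: "(\<lambda>x. w n x * g x) summable_on A" for n
    using g(1) by (rule summable_on_comparison_test) (use le w g in auto)
  have up: "infsum (\<lambda>x. w n x * g x) A \<le> infsum g A" for n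
    by (rule infsum_mono[OF sum g(1)]) (rule le)
  show "eventually (\<lambda>n. infsum (\<lambda>x. w n x * g x) A < y) sequentially" if "infsum g A < y" for y
    by (intro always_eventually allI le_less_trans[OF up that])
  fix y assume y: "y < infsum g A"
  have "eventually (\<lambda>F. y < sum g F) (finite_subsets_at_top A)"
    using has_sum_infsum[OF g(1)] y unfolding has_sum_def by (rule order_tendstoD)
  then obtain F where F: "finite F" "F \<subseteq> A" "y < sum g F"
    by (auto simp: eventually_finite_subsets_at_top)
  have "(\<lambda>n. \<Sum>x\<in>F. w n x * g x) \<longlonglongrightarrow> (\<Sum>x\<in>F. 1 * g x)"
    by (intro tendsto_intros w)
  then have "eventually (\<lambda>n. y < (\<Sum>x\<in>F. w n x * g x)) sequentially"
    using F(3) by (intro order_tendstoD) simp_all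
  then show "eventually (\<lambda>n. y < infsum (\<lambda>x. w n x * g x) A) sequentially"
  proof eventually_elim
    case (elim n)
    have "(\<Sum>x\<in>F. w n x * g x) \<le> infsum (\<lambda>x. w n x * g x) A"
      using F sum w(1) g(2) by (intro finite_sum_le_infsum) auto
    then show ?case using elim by simp
  qed
qed

text \<open>Summing over pairs makes \<open>s ^ k\<close> a weight on one fixed nonnegative family,
  so that the limit s -> 1 is taken in a single sum.\<close>

lemma mass_log_level:
  fixes p :: "real^'n"
  assumes s: "0 < s" "s < 1"
  shows "((\<lambda>(q, k). s ^ k * (cf (step ^ k) q / real k)) has_sum (- mass (log_level p s))) (Lam p \<times> UNIV)"
proof (rule has_sum_SigmaI)
  have nonneg: "0 \<le> s ^ k * (cf (step ^ k) q / real k)" for k and q :: "int^'n"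
    using s cf_step_power_nonneg[of k q] by simp
  show inner: "((\<lambda>k. case (q, k) of (q, k) \<Rightarrow> s ^ k * (cf (step ^ k) q / real k)) has_sum (- cf (logser s) q)) UNIV"
    for q :: "int^'n"
    using cf_logser_sums[OF s, of q] nonneg by (intro sums_nonneg_imp_has_sum) simp_all
  have "(cf (log_level p s) has_sum mass (log_level p s)) UNIV"
    unfolding mass_def by (intro has_sum_infsum cf_summable)
  then have "((\<lambda>q. - cf (log_level p s) q) has_sum - mass (log_level p s)) UNIV"
    by (simp add: has_sum_uminus)
  then show outer: "((\<lambda>q. - cf (logser s) q) has_sum - mass (log_level p s)) (Lam p)"
    by (rule has_sum_cong_neutral[THEN iffD1, rotated -1]) (auto simp: log_level_def restr.rep_eq)
  show "(\<lambda>(q, k). s ^ k * (cf (step ^ k) q / real k)) summable_on (Lam p \<times> UNIV)"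
    by (rule summable_on_SigmaI[OF inner has_sum_imp_summable[OF outer]]) (use nonneg in auto)
qed

text \<open>The solution is nonnegative and vanishes at 0, and since \<open>p\<close> is nonzero
  some neighbour of 0 lies strictly inside the half-space, where the solution is positive.\<close>

lemma Ham_pos:
  fixes p :: "real^'n"
  assumes p: "p \<noteq> 0"
  shows "Ham p > 0"
proof -
  have u: "usol p x = 0" if "zdot p x \<le> 0" for x
    using usol_properties(1)[OF p] that by (simp add: is_halfspace_sol_def)
  have nonneg: "usol p x \<ge> 0" for x
    using u[of x] usol_properties(2)[OF p, of x] by linarith
  obtain i where "p $ i \<noteq> 0" using p by (auto simp: vec_eq_iff)
  then have "zdot p (unitz i) > 0 \<or> zdot p (- unitz i) > 0"
    by (auto simp: zdot_unitz zdot_minus)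
  then have "usol p (unitz i) > 0 \<or> usol p (- unitz i) > 0"
    using usol_properties(2)[OF p] by blast
  then have "0 < (\<Sum>i\<in>UNIV. usol p (unitz i) + usol p (- unitz i))"
    using nonneg by (intro sum_pos2[of _ i]) (auto intro: add_pos_nonneg add_nonneg_pos)
  then show ?thesis using u[of 0] by (simp add: Ham_def dlap_def)
qed

theorem mainTheorem1:
  fixes p :: "real^'n"
  assumes "p \<noteq> 0"
  shows "(\<lambda>q. norm (Shat q)) summable_on Lam p \<and>
         complex_of_real ((Ham p)\<^sup>2) =
           2 * of_nat CARD('n) * exp (infsum Shat (Lam p)) * complex_of_real ((norm p)\<^sup>2)"
proof -
  note sol = usol_properties(1)[OF assms]
  obtain C where C: "C \<ge> 0" "\<And>x. \<bar>corrector p (usol p) x\<bar> \<le> C"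
    using corrector_bounded[OF sol] by blast
  define N where "N = Ham p / (2 * real CARD('n))"
  have N: "N > 0" using Ham_pos[OF assms] by (simp add: N_def)
  define e e0 where "e s = mass (exp (log_up p s))" and "e0 s = mass (exp (log_level p s))" for s
  have ex: "\<exists>m \<kappa>. \<bar>m\<bar> \<le> 2 * norm p \<and> \<bar>\<kappa>\<bar> \<le> 4 * (norm p)\<^sup>2 \<and>
      2 * e0 s * m\<^sup>2 = s * (norm p)\<^sup>2 / real CARD('n) + e s * e0 s * \<kappa> \<and>
      \<bar>e0 s * m + s * N\<bar> \<le> C * (e s * e0 s)" if s: "0 < s" "s < 1" for s
  proof -
    obtain a' \<kappa> where a': "\<And>x. cf a' x = zdot p x * cf (exp (log_up p s)) x"
      "norm a' \<le> 2 * norm p" "\<bar>\<kappa>\<bar> \<le> 4 * (norm p)\<^sup>2"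
      "2 * mass (exp (log_level p s)) * (mass a')\<^sup>2 =
        s * (norm p)\<^sup>2 / real CARD('n) + mass (exp (log_up p s)) * mass (exp (log_level p s)) * \<kappa>"
      by (rule first_second_moment[OF s, of p]) blast
    have "\<bar>mass a'\<bar> \<le> 2 * norm p" using abs_mass_le_norm[of a'] a'(2) by linarith
    moreover have "\<bar>e0 s * mass a' + s * N\<bar> \<le> C * (e s * e0 s)"
      using boundary_identity[OF s sol C(2) a'(1)] by (simp add: e_def e0_def N_def Ham_def)
    ultimately show ?thesis using a'(3,4) unfolding e_def e0_def by blast
  qed
  \<comment> \<open>The boundary identity gives s N <= e0 |m| + C e e0 with |m| <= 2|p| and e <=
    1.\<close>
  define K where "K = C + 2 * norm p"
  have K: "K > 0" using C(1) assms by (simp add: K_def add_nonneg_pos)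
  have e_bounds: "0 < e s" "e s \<le> 1" "0 < e0 s" "e0 s \<le> 1" "(e s)\<^sup>2 * e0 s = 1 - s" if "0 < s" "s < 1" for s
    using mass_exp_bounds[OF that, of p] mass_wiener_hopf(1)[OF that, of p] by (simp_all add: e_def e0_def)
  have lower: "s * N \<le> K * e0 s" if s: "0 < s" "s < 1" for s
  proof -
    obtain m where m: "\<bar>m\<bar> \<le> 2 * norm p" "\<bar>e0 s * m + s * N\<bar> \<le> C * (e s * e0 s)"
      using ex[OF s] by blast
    have "C * (e s * e0 s) \<le> C * (1 * e0 s)"
      using C(1) e_bounds[OF s] by (intro mult_left_mono mult_right_mono) auto
    moreover have "\<bar>e0 s * m\<bar> \<le> e0 s * (2 * norm p)"
      using m(1) e_bounds[OF s] by (simp add: abs_mult)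
    ultimately have "s * N \<le> C * e0 s + e0 s * (2 * norm p)" using m(2) by linarith
    then show ?thesis by (simp add: K_def algebra_simps)
  qed
  \<comment> \<open>A sequence tending to 1 from below; starting at 1/2 makes the lower bound for
    \<open>e0 (t n)\<close> uniform in \<open>n\<close>.\<close>
  define t where "t n = 1 - 1 / (real n + 2)" for n
  have t: "0 < t n" "t n < 1" "1 / 2 \<le> t n" for n
    by (auto simp: t_def field_simps)
  have t_lim: "t \<longlonglongrightarrow> 1"
    unfolding t_def by real_asymp
  define c0 where "c0 = N / (2 * K)"
  have c0: "c0 > 0" using N K by (simp add: c0_def)
  have e0_lower: "c0 \<le> e0 (t n)" for n
  proof -
    have "N / 2 \<le> t n * N" using mult_right_mono[OF t(3)[of n], of N] N by simp
    also have "\<dots> \<le> K * e0 (t n)" by (rule lower[OF t(1,2)])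
    finally show ?thesis using K by (simp add: c0_def divide_le_eq mult_ac)
  qed
  define G where "G = (\<lambda>(q :: int^'n, k). cf (step ^ k) q / real k)"
  have G_nonneg: "G x \<ge> 0" for x
    by (simp add: G_def case_prod_unfold cf_step_power_nonneg)
  have level: "((\<lambda>x. t n ^ snd x * G x) has_sum (- ln (e0 (t n)))) (Lam p \<times> UNIV)" for n
    using mass_log_level[OF t(1,2), of n p] by (simp add: G_def case_prod_unfold e0_def mass_exp)
  have G_sum: "G summable_on (Lam p \<times> UNIV)"
  proof (rule nonneg_bdd_above_summable_on[OF G_nonneg])
    \<comment> \<open>A finite sum at s = 1 is the limit of the sums weighted by
      \<open>t n ^ k\<close>, each dominated by the full sum \<open>- ln (e0 (t n))\<close>.\<close>
    have "sum G F \<le> - ln c0" if F: "finite F" "F \<subseteq> Lam p \<times> UNIV" for F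
    proof (rule LIMSEQ_le_const2)
      have "(\<lambda>n. \<Sum>x\<in>F. t n ^ snd x * G x) \<longlonglongrightarrow> (\<Sum>x\<in>F. 1 ^ snd x * G x)"
        by (intro tendsto_intros t_lim)
      then show "(\<lambda>n. \<Sum>x\<in>F. t n ^ snd x * G x) \<longlonglongrightarrow> sum G F" by simp
      have "(\<Sum>x\<in>F. t n ^ snd x * G x) \<le> - ln c0" for n
      proof -
        have "(\<Sum>x\<in>F. t n ^ snd x * G x) \<le> - ln (e0 (t n))"
          by (rule finite_sum_le_has_sum[OF level F]) (use t(1)[of n] G_nonneg in \<open>simp add: less_imp_le\<close>)
        also have "\<dots> \<le> - ln c0" using c0 e0_lower[of n] e_bounds(3)[OF t(1,2), of n] by simp
        finally show ?thesis .
      qed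
      then show "\<exists>n0. \<forall>n\<ge>n0. (\<Sum>x\<in>F. t n ^ snd x * G x) \<le> - ln c0" by blast
    qed
    then show "bdd_above (sum G ` {F. F \<subseteq> Lam p \<times> UNIV \<and> finite F})"
      by (auto simp: bdd_above_def)
  qed
  define Z where "Z = infsum G (Lam p \<times> UNIV)"
  have inner: "(\<lambda>k. G (q, k)) summable_on UNIV" if "q \<in> Lam p" for q
    using summable_on_SigmaD1[of "\<lambda>q k. G (q, k)" "Lam p" "\<lambda>_. UNIV" q] G_sum that by simp
  \<comment> \<open>The origin belongs to \<open>Lam p\<close>, so the bound just obtained includes
    the return probabilities required by \<open>Shat_eq\<close>.\<close>
  have "(\<lambda>k. G (0, k)) summable_on UNIV" by (rule inner) (simp add: Lam_def)
  then have zero: "summable (\<lambda>k. cf (step ^ k) (0 :: int^'n) / real k)"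
    by (auto simp: G_def dest: summable_on_imp_summable)
  have Shat: "Shat q = - complex_of_real (\<Sum>\<^sub>\<infinity>k. G (q, k))" if "q \<in> Lam p" for q
  proof -
    have "(\<Sum>\<^sub>\<infinity>k. G (q, k)) = (\<Sum>k. G (q, k))"
      using has_sum_imp_sums[OF has_sum_infsum[OF inner[OF that]]] by (simp add: sums_iff)
    then show ?thesis using Shat_eq(2)[OF zero, of q] by (simp add: G_def)
  qed
  have outer: "(\<lambda>q. \<Sum>\<^sub>\<infinity>k. G (q, k)) summable_on Lam p"
    using summable_on_Sigma_banach[of "\<lambda>q k. G (q, k)"] G_sum by simp
  have "norm (Shat q) = (\<Sum>\<^sub>\<infinity>k. G (q, k))" if "q \<in> Lam p" for q
    using Shat[OF that] infsum_nonneg[of UNIV "\<lambda>k. G (q, k)"] G_nonneg by simp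
  then have part1: "(\<lambda>q. norm (Shat q)) summable_on Lam p"
    using outer by (subst summable_on_cong) auto
  have "infsum Shat (Lam p) = (\<Sum>\<^sub>\<infinity>q\<in>Lam p. - complex_of_real (\<Sum>\<^sub>\<infinity>k. G (q, k)))"
    by (rule infsum_cong) (rule Shat)
  also have "\<dots> = - complex_of_real (\<Sum>\<^sub>\<infinity>q\<in>Lam p. \<Sum>\<^sub>\<infinity>k. G (q, k))"
  proof -
    have "((\<lambda>q. complex_of_real (\<Sum>\<^sub>\<infinity>k. G (q, k))) has_sum
        complex_of_real (\<Sum>\<^sub>\<infinity>q\<in>Lam p. \<Sum>\<^sub>\<infinity>k. G (q, k))) (Lam p)"
      by (rule has_sum_of_real[OF has_sum_infsum[OF outer]])
    then show ?thesis by (simp add: infsum_uminus infsumI)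
  qed
  also have "(\<Sum>\<^sub>\<infinity>q\<in>Lam p. \<Sum>\<^sub>\<infinity>k. G (q, k)) = Z"
    unfolding Z_def by (rule infsum_Sigma_banach[OF G_sum])
  finally have Shat_sum: "infsum Shat (Lam p) = - complex_of_real Z" .
  have "(\<lambda>n. - ln (e0 (t n))) \<longlonglongrightarrow> Z"
  proof -
    have "(\<lambda>n. infsum (\<lambda>x. t n ^ snd x * G x) (Lam p \<times> UNIV)) \<longlonglongrightarrow> Z"
      unfolding Z_def
    proof (rule infsum_weighted_tendsto[OF G_sum G_nonneg])
      show "0 \<le> t n ^ snd x" "t n ^ snd x \<le> 1" for n and x :: "(int^'n) \<times> nat"
        using t(1,2)[of n] by (auto intro: power_le_one)
      show "(\<lambda>n. t n ^ snd x) \<longlonglongrightarrow> 1" for x :: "(int^'n) \<times> nat"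
        using tendsto_power[OF t_lim, of "snd x"] by simp
    qed
    then show ?thesis using infsumI[OF level] by simp
  qed
  then have "(\<lambda>n. exp (- (- ln (e0 (t n))))) \<longlonglongrightarrow> exp (- Z)"
    by (intro tendsto_intros)
  then have e0_lim: "(\<lambda>n. e0 (t n)) \<longlonglongrightarrow> exp (- Z)"
    using e_bounds(3)[OF t(1,2)] by simp
  \<comment> \<open>From e^2 e0 = 1 - s, as the limit of e0 is positive.\<close>
  have e_lim: "(\<lambda>n. e (t n)) \<longlonglongrightarrow> 0"
  proof -
    have "(\<lambda>n. sqrt ((1 - t n) / e0 (t n))) \<longlonglongrightarrow> sqrt ((1 - 1) / exp (- Z))"
      by (intro tendsto_intros t_lim e0_lim) simp
    moreover have "sqrt ((1 - t n) / e0 (t n)) = e (t n)" for n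
      using e_bounds[OF t(1,2), of n] by (simp add: e_bounds(5)[OF t(1,2), symmetric])
    ultimately show ?thesis by simp
  qed
  obtain m \<kappa> where m: "\<And>n. \<bar>\<kappa> n\<bar> \<le> 4 * (norm p)\<^sup>2"
    "\<And>n. 2 * e0 (t n) * (m n)\<^sup>2 = t n * (norm p)\<^sup>2 / real CARD('n) + e (t n) * e0 (t n) * \<kappa> n"
    "\<And>n. \<bar>e0 (t n) * m n + t n * N\<bar> \<le> C * (e (t n) * e0 (t n))"
    using ex[OF t(1,2)] by metis
  have "(\<lambda>n. e0 (t n) * m n + t n * N) \<longlonglongrightarrow> 0"
  proof (rule Lim_null_comparison)
    show "\<forall>\<^sub>F n in sequentially. norm (e0 (t n) * m n + t n * N) \<le> C * (e (t n) * e0 (t n))"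
      using m(3) by simp
    show "(\<lambda>n. C * (e (t n) * e0 (t n))) \<longlonglongrightarrow> 0"
      using tendsto_mult[OF tendsto_const[of C] tendsto_mult[OF e_lim e0_lim]] by simp
  qed
  \<comment> \<open>Here e0 m tends to -N; squaring removes the sign.\<close>
  from tendsto_power[OF tendsto_diff[OF this tendsto_mult[OF t_lim tendsto_const[of N]]], of 2]
  have lim1: "(\<lambda>n. (e0 (t n) * m n)\<^sup>2) \<longlonglongrightarrow> N\<^sup>2" by simp
  have err: "(\<lambda>n. e (t n) * e0 (t n) * \<kappa> n) \<longlonglongrightarrow> 0"
  proof (rule Lim_null_comparison)
    show "\<forall>\<^sub>F n in sequentially. norm (e (t n) * e0 (t n) * \<kappa> n) \<le> e (t n) * e0 (t n) * (4 * (norm p)\<^sup>2)"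
      using m(1) e_bounds[OF t(1,2)] by (auto simp: abs_mult less_imp_le intro!: always_eventually mult_left_mono)
    show "(\<lambda>n. e (t n) * e0 (t n) * (4 * (norm p)\<^sup>2)) \<longlonglongrightarrow> 0"
      using tendsto_mult[OF tendsto_mult[OF e_lim e0_lim] tendsto_const[of "4 * (norm p)\<^sup>2"]] by simp
  qed
  \<comment> \<open>The second-moment identity is multiplied by e0 / 2, so that both relations speak
    about the same quantity (e0 m)^2 and no limit of \<open>m n\<close> itself is required.\<close>
  have "(e0 (t n) * m n)\<^sup>2 = e0 (t n) * (t n * (norm p)\<^sup>2 / real CARD('n) + e (t n) * e0 (t n) * \<kappa> n) / 2" for n
    unfolding m(2)[of n, symmetric] by (simp add: power2_eq_square)
  moreover have "(\<lambda>n. e0 (t n) * (t n * (norm p)\<^sup>2 / real CARD('n) + e (t n) * e0 (t n) * \<kappa> n) / 2)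
      \<longlonglongrightarrow> exp (- Z) * (1 * (norm p)\<^sup>2 / real CARD('n) + 0) / 2"
    by (intro tendsto_intros e0_lim t_lim err) simp_all
  ultimately have "(\<lambda>n. (e0 (t n) * m n)\<^sup>2) \<longlonglongrightarrow> exp (- Z) * (1 * (norm p)\<^sup>2 / real CARD('n) + 0) / 2"
    by (simp only:)
  from LIMSEQ_unique[OF lim1 this]
  have "N\<^sup>2 = exp (- Z) * (norm p)\<^sup>2 / (2 * real CARD('n))"
    by (simp add: mult.commute)
  then have "(Ham p)\<^sup>2 = 2 * real CARD('n) * exp (- Z) * (norm p)\<^sup>2"
    by (simp add: N_def power2_eq_square field_simps)
  then have "complex_of_real ((Ham p)\<^sup>2) = complex_of_real (2 * real CARD('n) * exp (- Z) * (norm p)\<^sup>2)"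
    by (simp only:)
  then have "complex_of_real ((Ham p)\<^sup>2) =
      2 * of_nat CARD('n) * exp (infsum Shat (Lam p)) * complex_of_real ((norm p)\<^sup>2)"
    by (simp add: Shat_sum exp_of_real[symmetric])
  with part1 show ?thesis by blast
qed

end
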